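(* Let $\theta\in\mathbb{R}$ be the deformation parameter. Suppose that the left $H$-coaction of the left $H$-comodule $(V,\rho)$ is non-trivial, i.e. there exists $v\in V$ such that $\rho(v)\neq\mathbf 1_H\otimes v$. Then the left $B$-module isomorphism $L_V\colon E_A(V)\to E_{A_\theta}(V)$, defined by $L_V(a\otimes v)=e^{\pi i\theta mn}a\otimes v$ for homogeneous $a\otimes v\in A^{((m+n,-m),n)}\otimes V^n$, does not intertwine between the actions of classical and deformed infinitesimal gauge transformations; that is, it is not the case that $L_V(s\triangleleft\zeta)=L_V(s)\,{}_\theta\!\triangleleft\zeta$ for all $s\in E_A(V)$ and all $\zeta\in E_A(\mathfrak h)=E_{A_\theta}(\mathfrak h)$.
   Context: Algebras are associative and unital over $\mathbb{C}$, $\otimes=\otimes_{\mathbb{C}}$. Sweedler notation: $\delta(a)=a_{\underline{0}}\otimes a_{\underline{1}}$ for right coactions, $\rho(a)=a_{\underline{-1}}\otimes a_{\underline{0}}$ for left coactions. $A=\mathcal{O}(\mathbb{S}^3)$ is the commutative $\ast$-algebra generated by $z_1,z_2$ modulo the $\ast$-ideal generated by the relation $z_1^\ast z_1+z_2^\ast z_2=\mathbf{1}$. $H=\mathcal{O}(U(1))$ is the commutative $\ast$-Hopf algebra generated by $t$ with $t^\ast t=\mathbf{1}$, $\Delta(t)=t\otimes t$, $\epsilon(t)=1$, $S(t)=t^\ast$. $\delta\colon A\to A\otimes H$ is the right $H$-coaction ($\ast$-algebra map) with $\delta(z_i)=z_i\otimes t$, $\delta(z_i^\ast)=z_i^\ast\otimes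 t^\ast$. $K=\mathcal{O}(\mathbb{T}^2)$ is the Hopf algebra with basis $\{t_{\mathbf m}:\mathbf m\in\mathbb{Z}^2\}$, $t_{\mathbf m}t_{\mathbf m'}=t_{\mathbf m+\mathbf m'}$, $\Delta(t_{\mathbf m})=t_{\mathbf m}\otimes t_{\mathbf m}$, $\epsilon(t_{\mathbf m})=1$, $S(t_{\mathbf m})=t_{\mathbf m}^\ast=t_{-\mathbf m}$. $\rho\colon A\to K\otimes A$ is the left $K$-coaction ($\ast$-algebra map) with $\rho(z_1)=t_{(1,0)}\otimes z_1$, $\rho(z_2)=t_{(0,1)}\otimes z_2$, $\rho(z_1^\ast)=t_{(-1,0)}\otimes z_1^\ast$, $\rho(z_2^\ast)=t_{(0,-1)}\otimes z_2^\ast$. For $\theta\in\mathbb{R}$ let $\sigma_\theta(t_{\mathbf m}\otimes t_{\mathbf m'})=\exp(\pi i\theta(m_1m_2'-m_2m_1'))$. $A_\theta$ is the same vector space with the same unit, involution and coactions, and product $a\star_\theta a'=\sigma_\theta(a_{\underline{-1}}\otimes a'_{\underline{-1}})\,a_{\underline 0}a'_{\underline 0}$. $B:=A^{\mathrm{co}H}=\{a\in A:\delta(a)=a\otimes\mathbf 1\}$ coincides with $A_\theta^{\mathrm{co}H}$ as an algebra. $A^{(\mathbf m,n)}=\{a\in A:\rho(a)=t_{\mathbf m}\otimes a,\ \delta(a)=a\otimes t^n\}$, and $A=\bigoplus_{m,n\in\mathbb{Z}}A^{((m+n,-m),n)}$. For a left $H$-comodule $(V,\rho)$, $V^n=\{v\in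 V:\rho(v)=t^n\otimes v\}$. The cotensor product is $A\,\square_HV=\{\sum_j a_j\otimes v_j\in A\otimes V:\sum_j\delta(a_j)\otimes v_j=\sum_j a_j\otimes\rho(v_j)\}=\bigoplus_{m,n}A^{((m+n,-m),n)}\otimes V^n$. $E_A(V)=A\,\square_HV$ with left $B$-action $b(a\otimes v)=(ba)\otimes v$; $E_{A_\theta}(V)=A_\theta\,\square_HV$ (same vector space) with left $B$-action $(b\star_\theta a)\otimes v$. Let $X\colon H\to\mathbb{C}$, $X(t^n)=n$, which spans $\mathfrak h=\mathrm{Der}_\epsilon(H)$ (endowed with the trivial left $H$-coaction). Infinitesimal gauge transformations are elements $\zeta=b\otimes X$, $b\in B$, of $E_{A_\theta}(\mathfrak h)=B\otimes\mathfrak h=E_A(\mathfrak h)$. They act on associated modules by $(a\otimes v)\triangleleft\zeta=ab\otimes X(v_{\underline{-1}})v_{\underline 0}$ on $E_A(V)$ (classical action) and by $(a\otimes v)\,{}_\theta\!\triangleleft\zeta=a\star_\theta b\otimes X(v_{\underline{-1}})v_{\underline 0}$ on $E_{A_\theta}(V)$ (deformed action).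
   Formalization: The formal theorem also assumes that θ is irrational or that some n with V^n ≠ 0 has nθ not an integer; otherwise (e.g. θ = 0, where L_V is the identity and both actions coincide) L_V does intertwine the actions and the claim fails. *)

theory Defs
  imports Complex_Main "HOL-Library.Poly_Mapping" "HOL-Library.Product_Plus"
begin

section \<open>Complex vector spaces and commutative complex algebras\<close>

class scaleC =
  fixes scaleC :: "complex \<Rightarrow> 'a \<Rightarrow> 'a" (infixr \<open>*\<^sub>C\<close> 75)

class complex_space = scaleC + ab_group_add +
  assumes scaleC_add_right: "c *\<^sub>C (x + y) = c *\<^sub>C x + c *\<^sub>C y"
    and scaleC_add_left: "(c + d) *\<^sub>C x = c *\<^sub>C x + d *\<^sub>C x"
    and scaleC_scaleC [simp]: "c *\<^sub>C d *\<^sub>C x = (c * d) *\<^sub>C x"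
    and scaleC_one [simp]: "1 *\<^sub>C x = x"

class comm_complex_algebra = comm_ring_1 + complex_space +
  assumes scaleC_mult_left: "(c *\<^sub>C x) * y = c *\<^sub>C (x * y)"

lemma (in comm_complex_algebra) scaleC_mult_right: "x * (c *\<^sub>C y) = c *\<^sub>C (x * y)"
  using scaleC_mult_left [of c y x] by (simp add: mult.commute)

global_interpretation cs: vector_space "scaleC :: complex \<Rightarrow> 'a \<Rightarrow> 'a::complex_space"
  by unfold_locales (simp_all add: scaleC_add_right scaleC_add_left)

global_interpretation csp: vector_space_pair
  "scaleC :: complex \<Rightarrow> 'a \<Rightarrow> 'a::complex_space" "scaleC :: complex \<Rightarrow> 'b \<Rightarrow> 'b::complex_space"
  by unfold_locales

abbreviation clinear :: "('a::complex_space \<Rightarrow> 'b::complex_space) \<Rightarrow> bool" where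
  "clinear \<equiv> Vector_Spaces.linear scaleC scaleC"

definition cbilinear :: "('a::complex_space \<Rightarrow> 'b::complex_space \<Rightarrow> 'c::complex_space) \<Rightarrow> bool" where
  "cbilinear f \<longleftrightarrow> (\<forall>a. clinear (f a)) \<and> (\<forall>b. clinear (\<lambda>a. f a b))"

lemma clinearI:
  assumes "\<And>x y. f (x + y) = f x + f y" and "\<And>c x. f (c *\<^sub>C x) = c *\<^sub>C f x"
  shows "clinear f"
  using assms by (auto simp: Vector_Spaces.linear_iff cs.vector_space_axioms)

lemma clinear_add: "clinear f \<Longrightarrow> f (x + y) = f x + f y"
  and clinear_scale: "clinear f \<Longrightarrow> f (c *\<^sub>C x) = c *\<^sub>C f x"
  and clinear_0: "clinear f \<Longrightarrow> f 0 = 0"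
  and clinear_diff: "clinear f \<Longrightarrow> f (x - y) = f x - f y"
  by (simp_all add: csp.linear_add csp.linear_scale csp.linear_0 csp.linear_diff)

lemma cbilinearI:
  assumes "\<And>a a' b. f (a + a') b = f a b + f a' b" "\<And>a b b'. f a (b + b') = f a b + f a b'"
    and "\<And>c a b. f (c *\<^sub>C a) b = c *\<^sub>C f a b" "\<And>c a b. f a (c *\<^sub>C b) = c *\<^sub>C f a b"
  shows "cbilinear f"
  unfolding cbilinear_def using assms by (auto intro!: clinearI)

lemma cbilinearD:
  assumes "cbilinear f"
  shows "f (a + a') b = f a b + f a' b" "f a (b + b') = f a b + f a b'"
    "f (c *\<^sub>C a) b = c *\<^sub>C f a b" "f a (c *\<^sub>C b) = c *\<^sub>C f a b"
proof -
  have r: "clinear (f a)" and l: "clinear (\<lambda>a. f a b)" for a b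
    using assms by (auto simp: cbilinear_def)
  show "f (a + a') b = f a b + f a' b" "f (c *\<^sub>C a) b = c *\<^sub>C f a b"
    using clinear_add[OF l] clinear_scale[OF l] by auto
  show "f a (b + b') = f a b + f a b'" "f a (c *\<^sub>C b) = c *\<^sub>C f a b"
    using clinear_add[OF r] clinear_scale[OF r] by auto
qed

lemma clinear_ident: "clinear (\<lambda>x. x)"
  by (rule clinearI) simp_all

lemma clinear_comp: "clinear f \<Longrightarrow> clinear g \<Longrightarrow> clinear (\<lambda>x. f (g x))"
  by (rule clinearI) (simp_all add: clinear_add clinear_scale)

lemma exists_functional:
  fixes a :: "'a::complex_space"
  assumes "a \<noteq> 0"
  obtains f :: "'a \<Rightarrow> complex" where "\<And>x y. f (x + y) = f x + f y" "\<And>c x. f (c *\<^sub>C x) = c * f x" "f a = 1"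
proof -
  interpret P: vector_space_pair "scaleC :: complex \<Rightarrow> 'a \<Rightarrow> 'a" "(*) :: complex \<Rightarrow> complex \<Rightarrow> complex"
    by unfold_locales (simp_all add: algebra_simps)
  have "cs.independent {a}" using assms by simp
  from P.linear_independent_extend[OF this, of "\<lambda>_. 1"]
  obtain g where "Vector_Spaces.linear scaleC (*) g" "g a = 1" by auto
  then show ?thesis using that[of g] by (simp add: P.linear_add P.linear_scale)
qed

instantiation complex :: comm_complex_algebra
begin
definition "c *\<^sub>C (z::complex) = c * z"
instance by standard (simp_all add: scaleC_complex_def algebra_simps)
end

instantiation poly_mapping :: (type, complex_space) complex_space
begin
lift_definition scaleC_poly_mapping :: "complex \<Rightarrow> ('a \<Rightarrow>\<^sub>0 'b) \<Rightarrow> ('a \<Rightarrow>\<^sub>0 'b)"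
  is "\<lambda>c f k. c *\<^sub>C f k"
  by (erule finite_subset[rotated]) auto
instance
  by standard (transfer, simp add: fun_eq_iff scaleC_add_right scaleC_add_left)+
end

lemma lookup_scaleC [simp]: "Poly_Mapping.lookup (c *\<^sub>C p) k = c *\<^sub>C Poly_Mapping.lookup p k"
  by transfer simp

lemma scaleC_single [simp]: "c *\<^sub>C Poly_Mapping.single k d = Poly_Mapping.single k (c *\<^sub>C d)"
  by (rule poly_mapping_eqI) (simp add: lookup_single when_def)

lemma poly_mapping_sum_singles:
  fixes p :: "'a \<Rightarrow>\<^sub>0 'b::comm_monoid_add"
  shows "p = (\<Sum>k\<in>Poly_Mapping.keys p. Poly_Mapping.single k (Poly_Mapping.lookup p k))"
proof (rule poly_mapping_eqI)
  fix k
  have "(\<Sum>i\<in>Poly_Mapping.keys p. Poly_Mapping.lookup p i when i = k) = (\<Sum>i\<in>Poly_Mapping.keys p. if i = k then Poly_Mapping.lookup p i else 0)"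
    by (rule sum.cong) (auto simp: when_def)
  then show "Poly_Mapping.lookup p k = Poly_Mapping.lookup (\<Sum>k\<in>Poly_Mapping.keys p. Poly_Mapping.single k (Poly_Mapping.lookup p k)) k"
    by (simp add: lookup_sum lookup_single sum.delta not_in_keys_iff_lookup_eq_zero)
qed

lemma poly_mapping_add_induct [case_names single add]:
  fixes p :: "'a \<Rightarrow>\<^sub>0 'b::comm_monoid_add"
  assumes single: "\<And>k c. P (Poly_Mapping.single k c)"
    and add: "\<And>p q. P p \<Longrightarrow> P q \<Longrightarrow> P (p + q)"
  shows "P p"
proof -
  have "P (\<Sum>k\<in>S. Poly_Mapping.single k (f k))" if "finite S" for S and f :: "'a \<Rightarrow> 'b"
    using that
  proof (induction S rule: finite_induct)
    case empty
    show ?case using single[of undefined 0] by simp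
  next
    case (insert x F)
    then show ?case by (simp add: single add)
  qed
  then show ?thesis using poly_mapping_sum_singles[of p] by (metis finite_keys)
qed

instance poly_mapping :: (comm_monoid_add, comm_complex_algebra) comm_complex_algebra
proof
  fix c :: complex and x y :: "'a \<Rightarrow>\<^sub>0 'b"
  show "(c *\<^sub>C x) * y = c *\<^sub>C (x * y)"
  proof (induction x rule: poly_mapping_add_induct)
    case (single k a)
    show ?case
      by (induction y rule: poly_mapping_add_induct)
        (simp_all add: mult_single scaleC_mult_left distrib_left scaleC_add_right)
  next
    case (add p q)
    then show ?case by (simp add: scaleC_add_right distrib_right)
  qed
qed

definition free_lift :: "('a \<Rightarrow> 'b::complex_space) \<Rightarrow> ('a \<Rightarrow>\<^sub>0 complex) \<Rightarrow> 'b" where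
  "free_lift f p = (\<Sum>k\<in>Poly_Mapping.keys p. Poly_Mapping.lookup p k *\<^sub>C f k)"

lemma free_lift_superset:
  assumes "finite S" "Poly_Mapping.keys p \<subseteq> S"
  shows "free_lift f p = (\<Sum>k\<in>S. Poly_Mapping.lookup p k *\<^sub>C f k)"
  unfolding free_lift_def
  by (rule sum.mono_neutral_left) (use assms in \<open>auto simp: in_keys_iff\<close>)

lemma free_lift_single [simp]: "free_lift f (Poly_Mapping.single k c) = c *\<^sub>C f k"
  using free_lift_superset[of "{k}" "Poly_Mapping.single k c" f] by simp

lemma clinear_free_lift: "clinear (free_lift f)"
proof (rule clinearI)
  fix p q :: "'a \<Rightarrow>\<^sub>0 complex" and c
  have "Poly_Mapping.keys (p + q) \<subseteq> Poly_Mapping.keys p \<union> Poly_Mapping.keys q" by (rule keys_add)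
  then show "free_lift f (p + q) = free_lift f p + free_lift f q"
    by (simp add: free_lift_superset[of "Poly_Mapping.keys p \<union> Poly_Mapping.keys q"] lookup_add scaleC_add_left sum.distrib)
  have "Poly_Mapping.keys (c *\<^sub>C p) \<subseteq> Poly_Mapping.keys p" by (auto simp: in_keys_iff)
  then show "free_lift f (c *\<^sub>C p) = c *\<^sub>C free_lift f p"
    by (simp add: free_lift_superset[of "Poly_Mapping.keys p"] scaleC_complex_def cs.scale_sum_right)
qed

section \<open>The tensor product over the complex numbers\<close>

definition tensor_relators :: "('a::complex_space \<times> 'b::complex_space \<Rightarrow>\<^sub>0 complex) set" where
  "tensor_relators =
     {Poly_Mapping.single (a + a', b) 1 - Poly_Mapping.single (a, b) 1 - Poly_Mapping.single (a', b) 1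
        | a a' b. True} \<union>
     {Poly_Mapping.single (a, b + b') 1 - Poly_Mapping.single (a, b) 1 - Poly_Mapping.single (a, b') 1
        | a b b'. True} \<union>
     {Poly_Mapping.single (c *\<^sub>C a, b) 1 - Poly_Mapping.single (a, b) c | c a b. True} \<union>
     {Poly_Mapping.single (a, c *\<^sub>C b) 1 - Poly_Mapping.single (a, b) c | c a b. True}"

definition tensor_eq ::
    "('a::complex_space \<times> 'b::complex_space \<Rightarrow>\<^sub>0 complex) \<Rightarrow> ('a \<times> 'b \<Rightarrow>\<^sub>0 complex) \<Rightarrow> bool" where
  "tensor_eq p q \<longleftrightarrow> p - q \<in> cs.span tensor_relators"

lemma equivp_tensor_eq: "equivp tensor_eq"
proof (rule equivpI)
  show "reflp tensor_eq" by (auto simp: reflp_def tensor_eq_def cs.span_zero)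
  show "symp tensor_eq"
    unfolding symp_def tensor_eq_def by (metis cs.span_neg minus_diff_eq)
  show "transp tensor_eq"
  proof (rule transpI)
    fix p q r
    assume "tensor_eq p q" "tensor_eq q r"
    then have "(p - q) + (q - r) \<in> cs.span tensor_relators"
      unfolding tensor_eq_def by (rule cs.span_add)
    then show "tensor_eq p r" by (simp add: tensor_eq_def)
  qed
qed

quotient_type (overloaded) ('a, 'b) tensor =
  "('a::complex_space \<times> 'b::complex_space \<Rightarrow>\<^sub>0 complex)" / tensor_eq
  by (rule equivp_tensor_eq)

instantiation tensor :: (complex_space, complex_space) complex_space
begin
lift_definition zero_tensor :: "('a, 'b) tensor" is 0 .
lift_definition plus_tensor :: "('a, 'b) tensor \<Rightarrow> ('a, 'b) tensor \<Rightarrow> ('a, 'b) tensor" is "(+)"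
  unfolding tensor_eq_def by (drule (1) cs.span_add) (simp add: algebra_simps)
lift_definition minus_tensor :: "('a, 'b) tensor \<Rightarrow> ('a, 'b) tensor \<Rightarrow> ('a, 'b) tensor" is "(-)"
  unfolding tensor_eq_def by (drule (1) cs.span_diff) (simp add: algebra_simps)
lift_definition uminus_tensor :: "('a, 'b) tensor \<Rightarrow> ('a, 'b) tensor" is "uminus"
  unfolding tensor_eq_def by (drule cs.span_neg) (simp add: algebra_simps)
lift_definition scaleC_tensor :: "complex \<Rightarrow> ('a, 'b) tensor \<Rightarrow> ('a, 'b) tensor" is "scaleC"
  unfolding tensor_eq_def by (simp add: cs.span_scale flip: cs.scale_right_diff_distrib)
instance
  by standard
    (transfer, simp add: tensor_eq_def cs.span_zero algebra_simps scaleC_add_right scaleC_add_left)+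
end

lift_definition tensor :: "'a::complex_space \<Rightarrow> 'b::complex_space \<Rightarrow> ('a, 'b) tensor" (infixr \<open>\<otimes>\<close> 76)
  is "\<lambda>a b. Poly_Mapping.single (a, b) 1" .

text \<open>The linear map out of the tensor product induced by a bilinear map; for a map that is
  not bilinear the value is the dummy \<open>0\<close>.\<close>

lift_definition tensor_lift ::
    "('a::complex_space \<Rightarrow> 'b::complex_space \<Rightarrow> 'c::complex_space) \<Rightarrow> ('a, 'b) tensor \<Rightarrow> 'c"
  is "\<lambda>f p. if cbilinear f then free_lift (\<lambda>(a, b). f a b) p else 0"
proof -
  fix f :: "'a \<Rightarrow> 'b \<Rightarrow> 'c" and p q :: "'a \<times> 'b \<Rightarrow>\<^sub>0 complex"
  let ?L = "free_lift (\<lambda>(a, b). f a b)"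
  assume pq: "tensor_eq p q"
  show "(if cbilinear f then ?L p else 0) = (if cbilinear f then ?L q else 0)"
  proof (cases "cbilinear f")
    case True
    have lin: "clinear ?L" by (rule clinear_free_lift)
    have "?L x = 0" if "x \<in> cs.span tensor_relators" for x
      using that
    proof (induction rule: cs.span_induct_alt)
      case base
      show ?case by (simp add: clinear_0[OF lin])
    next
      case (step c x y)
      then show ?case
        by (auto simp: tensor_relators_def clinear_add[OF lin] clinear_scale[OF lin]
            clinear_diff[OF lin] cbilinearD[OF True])
    qed
    then have "?L (p - q) = 0" using pq by (simp add: tensor_eq_def)
    then show ?thesis by (simp add: clinear_diff[OF lin])
  qed simp
qed

lemma tensor_eqI_relator: "p - q \<in> tensor_relators \<Longrightarrow> tensor_eq p q"
  unfolding tensor_eq_def by (rule cs.span_base)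

lemma tensor_add_left: "(a + a') \<otimes> b = a \<otimes> b + a' \<otimes> b"
  by (transfer, rule tensor_eqI_relator, unfold tensor_relators_def diff_diff_eq[symmetric]) blast

lemma tensor_add_right: "a \<otimes> (b + b') = a \<otimes> b + a \<otimes> b'"
  by (transfer, rule tensor_eqI_relator, unfold tensor_relators_def diff_diff_eq[symmetric]) blast

lemma tensor_scale_left: "(c *\<^sub>C a) \<otimes> b = c *\<^sub>C a \<otimes> b"
  by (transfer, rule tensor_eqI_relator,
      unfold tensor_relators_def scaleC_single scaleC_complex_def mult_1_right) blast

lemma tensor_scale_right: "a \<otimes> (c *\<^sub>C b) = c *\<^sub>C a \<otimes> b"
  by (transfer, rule tensor_eqI_relator,
      unfold tensor_relators_def scaleC_single scaleC_complex_def mult_1_right) blast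

lemmas tensor_simps = tensor_add_left tensor_add_right tensor_scale_left tensor_scale_right

lemma cbilinear_tensor: "cbilinear (\<otimes>)"
  by (rule cbilinearI) (simp_all add: tensor_simps)

lemma tensor_lift_tensor: "cbilinear f \<Longrightarrow> tensor_lift f (a \<otimes> b) = f a b"
  by transfer simp

lemma clinear_tensor_lift: "clinear (tensor_lift f)"
proof (rule clinearI)
  fix x y :: "('a, 'b) tensor" and c
  show "tensor_lift f (x + y) = tensor_lift f x + tensor_lift f y"
    by transfer (simp add: clinear_add[OF clinear_free_lift])
  show "tensor_lift f (c *\<^sub>C x) = c *\<^sub>C tensor_lift f x"
    by transfer (simp add: clinear_scale[OF clinear_free_lift])
qed

lemmas tensor_lift_add = clinear_add[OF clinear_tensor_lift]
  and tensor_lift_scale = clinear_scale[OF clinear_tensor_lift]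
  and tensor_lift_0 = clinear_0[OF clinear_tensor_lift]

lemma tensor_induct [case_names tensor add, induct type: tensor]:
  assumes tens: "\<And>a b. P (a \<otimes> b)"
    and add: "\<And>x y. P x \<Longrightarrow> P y \<Longrightarrow> P (x + y)"
  shows "P x"
proof -
  have "P (abs_tensor p)" for p
  proof (induction p rule: poly_mapping_add_induct)
    case (single k c)
    obtain a b where k: "k = (a, b)" by (cases k)
    have "abs_tensor (Poly_Mapping.single k c) = c *\<^sub>C a \<otimes> b"
      unfolding k tensor.abs_eq scaleC_tensor.abs_eq by (simp add: scaleC_complex_def)
    then show ?case using tens[of "c *\<^sub>C a" b] by (simp add: tensor_scale_left)
  next
    case (add p q)
    then show ?case using assms(2) by (simp add: plus_tensor.abs_eq[symmetric])
  qed
  then show ?thesis by (metis tensor.abs_induct)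
qed

lemma tensor_eqI:
  assumes "clinear f" "clinear g" "\<And>a b. f (a \<otimes> b) = g (a \<otimes> b)"
  shows "f x = g x"
  by (induction x) (simp_all add: assms clinear_add)

lemma tensor_lift_cong_add:
  assumes "cbilinear f" "cbilinear g"
  shows "tensor_lift (\<lambda>a b. f a b + g a b) x = tensor_lift f x + tensor_lift g x"
proof -
  have "cbilinear (\<lambda>a b. f a b + g a b)"
    by (rule cbilinearI) (simp_all add: cbilinearD[OF assms(1)] cbilinearD[OF assms(2)] scaleC_add_right)
  then show ?thesis
    by (induction x) (simp_all add: tensor_lift_tensor tensor_lift_add assms)
qed

lemma tensor_lift_cong_scale:
  assumes "cbilinear f"
  shows "tensor_lift (\<lambda>a b. c *\<^sub>C f a b) x = c *\<^sub>C tensor_lift f x"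
proof -
  have "cbilinear (\<lambda>a b. c *\<^sub>C f a b)"
    by (rule cbilinearI) (simp_all add: cbilinearD[OF assms(1)] scaleC_add_right mult.commute)
  then show ?thesis
    by (induction x) (simp_all add: tensor_lift_tensor tensor_lift_add assms scaleC_add_right)
qed

lemma tensor_nonzero:
  assumes "a \<noteq> 0" "b \<noteq> 0"
  shows "a \<otimes> b \<noteq> 0"
proof
  assume 0: "a \<otimes> b = 0"
  obtain f g where f: "\<And>x y. f (x + y) = f x + f y" "\<And>c x. f (c *\<^sub>C x) = c * f x" "f a = 1"
    and g: "\<And>x y. g (x + y) = g x + g y" "\<And>c x. g (c *\<^sub>C x) = c * g x" "g b = 1"
    using exists_functional[OF assms(1)] exists_functional[OF assms(2)] by metis
  have "cbilinear (\<lambda>x y. f x * g y)"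
    by (rule cbilinearI) (simp_all add: f g algebra_simps scaleC_complex_def)
  from tensor_lift_tensor[OF this, of a b] show False
    by (simp add: 0 f g tensor_lift_0)
qed

definition tensor_map ::
    "('a::complex_space \<Rightarrow> 'c::complex_space) \<Rightarrow> ('b::complex_space \<Rightarrow> 'd::complex_space)
      \<Rightarrow> ('a, 'b) tensor \<Rightarrow> ('c, 'd) tensor" where
  "tensor_map f g = tensor_lift (\<lambda>a b. f a \<otimes> g b)"

lemma tensor_map_tensor:
  assumes "clinear f" "clinear g"
  shows "tensor_map f g (a \<otimes> b) = f a \<otimes> g b"
  unfolding tensor_map_def
  by (rule tensor_lift_tensor, rule cbilinearI)
    (simp_all add: clinear_add[OF assms(1)] clinear_add[OF assms(2)]
      clinear_scale[OF assms(1)] clinear_scale[OF assms(2)] tensor_simps)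

lemma clinear_tensor_map: "clinear (tensor_map f g)"
  unfolding tensor_map_def by (rule clinear_tensor_lift)

definition tensor_assoc ::
    "(('a::complex_space, 'b::complex_space) tensor, 'c::complex_space) tensor \<Rightarrow> ('a, ('b, 'c) tensor) tensor" where
  "tensor_assoc = tensor_lift (\<lambda>x c. tensor_lift (\<lambda>a b. a \<otimes> b \<otimes> c) x)"

lemma clinear_tensor_assoc: "clinear tensor_assoc"
  unfolding tensor_assoc_def by (rule clinear_tensor_lift)

lemma tensor_assoc_tensor: "tensor_assoc ((a \<otimes> b) \<otimes> c) = a \<otimes> b \<otimes> c"
proof -
  have 1: "cbilinear (\<lambda>a b. a \<otimes> b \<otimes> (c::'c))" for c
    by (rule cbilinearI) (simp_all add: tensor_simps)
  have "cbilinear (\<lambda>x c. tensor_lift (\<lambda>a b. a \<otimes> b \<otimes> (c::'c)) (x::('a, 'b) tensor))"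
    by (rule cbilinearI)
      (simp_all add: tensor_lift_add tensor_lift_scale tensor_simps
        tensor_lift_cong_add[OF 1 1] tensor_lift_cong_scale[OF 1])
  then show ?thesis
    unfolding tensor_assoc_def by (simp add: tensor_lift_tensor 1)
qed

lemma cbilinear_mult_tensor_inner:
  "cbilinear (\<lambda>a' b'. (a * a') \<otimes> (b * b'))"
  for a :: "'a::comm_complex_algebra" and b :: "'b::comm_complex_algebra"
  by (rule cbilinearI) (simp_all add: distrib_left scaleC_mult_right tensor_simps)

lemma cbilinear_mult_tensor_outer:
  "cbilinear (\<lambda>a b. tensor_lift (\<lambda>a' b'. (a * a') \<otimes> (b * b')) y)"
  for y :: "('a::comm_complex_algebra, 'b::comm_complex_algebra) tensor"
  by (rule cbilinearI)
    (simp_all add: distrib_right scaleC_mult_left tensor_simps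
      tensor_lift_cong_add[OF cbilinear_mult_tensor_inner cbilinear_mult_tensor_inner]
      tensor_lift_cong_scale[OF cbilinear_mult_tensor_inner])

instantiation tensor :: (comm_complex_algebra, comm_complex_algebra) comm_complex_algebra
begin

definition one_tensor :: "('a, 'b) tensor" where "1 = 1 \<otimes> 1"

definition times_tensor :: "('a, 'b) tensor \<Rightarrow> ('a, 'b) tensor \<Rightarrow> ('a, 'b) tensor" where
  "x * y = tensor_lift (\<lambda>a b. tensor_lift (\<lambda>a' b'. (a * a') \<otimes> (b * b')) y) x"

lemma mult_tensor_tensor: "(a \<otimes> b) * (a' \<otimes> b') = (a * a') \<otimes> (b * b')" for a a' :: 'a and b b' :: 'b
  unfolding times_tensor_def tensor_lift_tensor[OF cbilinear_mult_tensor_outer]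
  by (rule tensor_lift_tensor[OF cbilinear_mult_tensor_inner])

instance
proof
  fix x y z :: "('a, 'b) tensor" and c
  have dr: "(x + y) * z = x * z + y * z" for x y z :: "('a, 'b) tensor"
    by (simp add: times_tensor_def tensor_lift_add)
  have dl: "x * (y + z) = x * y + x * z" for x y z :: "('a, 'b) tensor"
  proof (induction x)
    case (tensor a b)
    show ?case
      unfolding times_tensor_def tensor_lift_tensor[OF cbilinear_mult_tensor_outer]
      by (rule tensor_lift_add)
  qed (simp add: dr algebra_simps)
  show "(x + y) * z = x * z + y * z" by (rule dr)
  show "x * y = y * x"
  proof (induction x)
    case (tensor a b)
    show ?case by (induction y) (simp_all add: mult_tensor_tensor mult.commute dl dr)
  qed (simp add: dl dr)
  show "x * y * z = x * (y * z)"
  proof (induction x)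
    case (tensor a b)
    show ?case
    proof (induction y)
      case (tensor a' b')
      show ?case by (induction z) (simp_all add: mult_tensor_tensor mult.assoc dl)
    qed (simp add: dl dr)
  qed (simp add: dl dr)
  show "1 * x = x"
    by (induction x) (simp_all add: one_tensor_def mult_tensor_tensor dl)
  show "(c *\<^sub>C x) * y = c *\<^sub>C (x * y)"
    by (simp add: times_tensor_def tensor_lift_scale)
  show "(0::('a, 'b) tensor) \<noteq> 1"
    using tensor_nonzero[of "1::'a" "1::'b"] by (simp add: one_tensor_def)
qed

end

section \<open>The Hopf algebras of the circle and of the 2-torus\<close>

text \<open>For an abelian group \<open>G\<close>, the type \<open>G \<Rightarrow>\<^sub>0 complex\<close> is the group algebra of \<open>G\<close>
  (its multiplication is convolution); \<open>tpow g\<close> is the basis element indexed by \<open>g\<close>.\<close>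

type_synonym OU1 = "int \<Rightarrow>\<^sub>0 complex"
type_synonym OT2 = "int \<times> int \<Rightarrow>\<^sub>0 complex"

definition tpow :: "'g \<Rightarrow> ('g \<Rightarrow>\<^sub>0 complex)" where
  "tpow g = Poly_Mapping.single g 1"

definition comult :: "('g \<Rightarrow>\<^sub>0 complex) \<Rightarrow> ('g \<Rightarrow>\<^sub>0 complex, 'g \<Rightarrow>\<^sub>0 complex) tensor" where
  "comult = free_lift (\<lambda>g. tpow g \<otimes> tpow g)"

definition counit :: "('g \<Rightarrow>\<^sub>0 complex) \<Rightarrow> complex" where
  "counit = free_lift (\<lambda>g. 1)"

lemma tpow_add: "tpow (g + h) = tpow g * tpow h" for g h :: "'g::comm_monoid_add"
  by (simp add: tpow_def mult_single)

lemma tpow_0: "tpow 0 = (1 :: 'g::comm_monoid_add \<Rightarrow>\<^sub>0 complex)"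
  by (simp add: tpow_def)

lemma comult_tpow: "comult (tpow g) = tpow g \<otimes> tpow g"
  by (simp add: comult_def tpow_def[of g])

lemma counit_tpow: "counit (tpow g) = 1"
  by (simp add: counit_def tpow_def)

definition left_comodule :: "('v::complex_space \<Rightarrow> (OU1, 'v) tensor) \<Rightarrow> bool" where
  "left_comodule \<rho> \<longleftrightarrow>
     clinear \<rho> \<and>
     (\<forall>v. tensor_assoc (tensor_map comult (\<lambda>w. w) (\<rho> v)) = tensor_map (\<lambda>h. h) \<rho> (\<rho> v)) \<and>
     (\<forall>v. tensor_lift (\<lambda>h w. counit h *\<^sub>C w) (\<rho> v) = v)"

definition weight_space :: "('v::complex_space \<Rightarrow> (OU1, 'v) tensor) \<Rightarrow> int \<Rightarrow> 'v set" where
  "weight_space \<rho> n = {v. \<rho> v = tpow n \<otimes> v}"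

section \<open>The coordinate algebra of the 3-sphere\<close>

datatype gen = Z1 | Z2 | Z1s | Z2s

lemma UNIV_gen: "UNIV = {Z1, Z2, Z1s, Z2s}"
  using gen.exhaust by auto

instance gen :: finite
  by standard (simp add: UNIV_gen)

fun gen_star :: "gen \<Rightarrow> gen" where
  "gen_star Z1 = Z1s" | "gen_star Z2 = Z2s" | "gen_star Z1s = Z1" | "gen_star Z2s = Z2"

lemma gen_star_gen_star [simp]: "gen_star (gen_star g) = g"
  by (cases g) simp_all

lemma inj_gen_star [simp]: "inj gen_star"
  by (metis gen_star_gen_star injI)

text \<open>The free commutative \<open>*\<close>-algebra on two generators: polynomials in the four variables
  \<open>gen\<close>, with the conjugate-linear involution exchanging \<open>z\<^sub>i\<close> and \<open>z\<^sub>i\<^sup>*\<close>.\<close>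

type_synonym gen_poly = "(gen \<Rightarrow>\<^sub>0 nat) \<Rightarrow>\<^sub>0 complex"

definition gvar :: "gen \<Rightarrow> gen_poly" where
  "gvar g = Poly_Mapping.single (Poly_Mapping.single g 1) 1"

definition monom_star :: "(gen \<Rightarrow>\<^sub>0 nat) \<Rightarrow> (gen \<Rightarrow>\<^sub>0 nat)" where
  "monom_star = Poly_Mapping.map_key gen_star"

lemma lookup_monom_star: "Poly_Mapping.lookup (monom_star m) g = Poly_Mapping.lookup m (gen_star g)"
  by (simp add: monom_star_def map_key.rep_eq)

lemma monom_star_monom_star [simp]: "monom_star (monom_star m) = m"
  by (rule poly_mapping_eqI) (simp add: lookup_monom_star)

lemma monom_star_add: "monom_star (m + m') = monom_star m + monom_star m'"
  by (rule poly_mapping_eqI) (simp add: lookup_monom_star lookup_add)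

lemma inj_monom_star [simp]: "inj monom_star"
  by (metis monom_star_monom_star injI)

definition poly_star :: "gen_poly \<Rightarrow> gen_poly" where
  "poly_star p = Poly_Mapping.map cnj (Poly_Mapping.map_key monom_star p)"

lemma lookup_poly_star: "Poly_Mapping.lookup (poly_star p) m = cnj (Poly_Mapping.lookup p (monom_star m))"
  by (simp add: poly_star_def map.rep_eq map_key.rep_eq when_def)

lemma poly_star_add: "poly_star (p + q) = poly_star p + poly_star q"
  by (rule poly_mapping_eqI) (simp add: lookup_poly_star lookup_add)

lemma poly_star_diff: "poly_star (p - q) = poly_star p - poly_star q"
  by (rule poly_mapping_eqI) (simp add: lookup_poly_star lookup_minus)

lemma poly_star_single: "poly_star (Poly_Mapping.single m c) = Poly_Mapping.single (monom_star m) (cnj c)"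
proof (rule poly_mapping_eqI)
  fix k
  have "m = monom_star k \<longleftrightarrow> monom_star m = k" by auto
  then show "Poly_Mapping.lookup (poly_star (Poly_Mapping.single m c)) k =
      Poly_Mapping.lookup (Poly_Mapping.single (monom_star m) (cnj c)) k"
    by (simp add: lookup_poly_star lookup_single when_def)
qed

lemma poly_star_mult: "poly_star (p * q) = poly_star p * poly_star q"
proof (induction p rule: poly_mapping_add_induct)
  case (single k c)
  show ?case
    by (induction q rule: poly_mapping_add_induct)
      (simp_all add: mult_single poly_star_single monom_star_add distrib_left poly_star_add)
qed (simp add: distrib_right poly_star_add)

lemma poly_star_gvar: "poly_star (gvar g) = gvar (gen_star g)"
proof -
  have "monom_star (Poly_Mapping.single g 1) = Poly_Mapping.single (gen_star g) 1"
    by (rule poly_mapping_eqI) (auto simp: lookup_monom_star lookup_single when_def)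
  then show ?thesis by (simp add: gvar_def poly_star_single)
qed

lemma poly_star_1: "poly_star 1 = 1"
  using poly_star_single[of 0 1] by (simp add: monom_star_def)

definition sphere_relator :: gen_poly where
  "sphere_relator = gvar Z1s * gvar Z1 + gvar Z2s * gvar Z2 - 1"

inductive_set sphere_ideal :: "gen_poly set" where
  relator: "sphere_relator \<in> sphere_ideal"
| add: "p \<in> sphere_ideal \<Longrightarrow> q \<in> sphere_ideal \<Longrightarrow> p + q \<in> sphere_ideal"
| mult: "p \<in> sphere_ideal \<Longrightarrow> r * p \<in> sphere_ideal"
| star: "p \<in> sphere_ideal \<Longrightarrow> poly_star p \<in> sphere_ideal"

lemma sphere_ideal_0: "0 \<in> sphere_ideal"
  using sphere_ideal.mult[OF sphere_ideal.relator, of 0] by simp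

lemma sphere_ideal_uminus: "p \<in> sphere_ideal \<Longrightarrow> - p \<in> sphere_ideal"
  using sphere_ideal.mult[of p "-1"] by simp

lemma sphere_ideal_diff: "p \<in> sphere_ideal \<Longrightarrow> q \<in> sphere_ideal \<Longrightarrow> p - q \<in> sphere_ideal"
  using sphere_ideal.add[OF _ sphere_ideal_uminus] by fastforce

lemma sphere_ideal_scaleC: "p \<in> sphere_ideal \<Longrightarrow> c *\<^sub>C p \<in> sphere_ideal"
  using sphere_ideal.mult[of p "c *\<^sub>C 1"] by (simp add: scaleC_mult_left)

lemma sphere_ideal_principal: "p \<in> sphere_ideal \<Longrightarrow> \<exists>q. p = q * sphere_relator"
proof (induction rule: sphere_ideal.induct)
  case relator
  show ?case by (metis mult_1)
next
  case (add p q)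
  then show ?case by (metis distrib_right)
next
  case (mult p r)
  then show ?case by (metis mult.assoc)
next
  case (star p)
  have "poly_star sphere_relator = sphere_relator"
    by (simp add: sphere_relator_def poly_star_add poly_star_diff poly_star_mult poly_star_gvar
        poly_star_1 mult.commute)
  with star show ?case by (metis poly_star_mult)
qed

text \<open>The algebra map out of the polynomial algebra with prescribed values on the variables.\<close>

definition poly_eval :: "(gen \<Rightarrow> 'a::comm_complex_algebra) \<Rightarrow> gen_poly \<Rightarrow> 'a" where
  "poly_eval f = free_lift (\<lambda>m. \<Prod>g\<in>UNIV. f g ^ Poly_Mapping.lookup m g)"

lemma clinear_poly_eval: "clinear (poly_eval f)"
  unfolding poly_eval_def by (rule clinear_free_lift)

lemmas poly_eval_add = clinear_add[OF clinear_poly_eval]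
  and poly_eval_diff = clinear_diff[OF clinear_poly_eval]
  and poly_eval_scale = clinear_scale[OF clinear_poly_eval]

lemma poly_eval_gvar: "poly_eval f (gvar g) = f g"
proof -
  have "(\<Prod>h\<in>UNIV. f h ^ Poly_Mapping.lookup (Poly_Mapping.single g 1) h) =
      (\<Prod>h\<in>UNIV. if h = g then f h else 1)"
    by (rule prod.cong) (auto simp: lookup_single when_def)
  then show ?thesis by (simp add: poly_eval_def gvar_def)
qed

lemma poly_eval_1: "poly_eval f 1 = 1"
proof -
  have "poly_eval f (Poly_Mapping.single 0 1) = 1"
    unfolding poly_eval_def free_lift_single by simp
  then show ?thesis by simp
qed

lemma poly_eval_mult: "poly_eval f (p * q) = poly_eval f p * poly_eval f q"
proof (induction p rule: poly_mapping_add_induct)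
  case (single k c)
  show ?case
  proof (induction q rule: poly_mapping_add_induct)
    case (single k' c')
    show ?case
      by (simp add: poly_eval_def mult_single lookup_add power_add prod.distrib scaleC_mult_left
          scaleC_mult_right)
  qed (simp add: distrib_left poly_eval_add)
qed (simp add: distrib_right poly_eval_add)

lemma poly_eval_sphere_ideal:
  assumes "f Z1s * f Z1 + f Z2s * f Z2 = 1" "p \<in> sphere_ideal"
  shows "poly_eval f p = 0"
proof -
  have "poly_eval f sphere_relator = 0"
    using assms(1)
    by (simp add: sphere_relator_def poly_eval_add poly_eval_diff poly_eval_mult poly_eval_gvar poly_eval_1)
  then show ?thesis
    using sphere_ideal_principal[OF assms(2)] by (auto simp: poly_eval_mult)
qed

definition sphere_eq :: "gen_poly \<Rightarrow> gen_poly \<Rightarrow> bool" where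
  "sphere_eq p q \<longleftrightarrow> p - q \<in> sphere_ideal"

lemma equivp_sphere_eq: "equivp sphere_eq"
proof (rule equivpI)
  show "reflp sphere_eq" by (auto simp: reflp_def sphere_eq_def sphere_ideal_0)
  show "symp sphere_eq"
    unfolding symp_def sphere_eq_def by (metis sphere_ideal_uminus minus_diff_eq)
  show "transp sphere_eq"
  proof (rule transpI)
    fix p q r
    assume "sphere_eq p q" "sphere_eq q r"
    then have "(p - q) + (q - r) \<in> sphere_ideal"
      unfolding sphere_eq_def by (rule sphere_ideal.add)
    then show "sphere_eq p r" by (simp add: sphere_eq_def)
  qed
qed

quotient_type OS3 = gen_poly / sphere_eq
  by (rule equivp_sphere_eq)

instantiation OS3 :: comm_complex_algebra
begin
lift_definition zero_OS3 :: OS3 is 0 .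
lift_definition one_OS3 :: OS3 is 1 .
lift_definition plus_OS3 :: "OS3 \<Rightarrow> OS3 \<Rightarrow> OS3" is "(+)"
  unfolding sphere_eq_def by (drule (1) sphere_ideal.add) (simp add: algebra_simps)
lift_definition minus_OS3 :: "OS3 \<Rightarrow> OS3 \<Rightarrow> OS3" is "(-)"
  unfolding sphere_eq_def by (drule (1) sphere_ideal_diff) (simp add: algebra_simps)
lift_definition uminus_OS3 :: "OS3 \<Rightarrow> OS3" is uminus
  unfolding sphere_eq_def by (drule sphere_ideal_uminus) (simp add: algebra_simps)
lift_definition scaleC_OS3 :: "complex \<Rightarrow> OS3 \<Rightarrow> OS3" is scaleC
  unfolding sphere_eq_def by (simp add: sphere_ideal_scaleC flip: cs.scale_right_diff_distrib)
lift_definition times_OS3 :: "OS3 \<Rightarrow> OS3 \<Rightarrow> OS3" is "(*)"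
proof -
  fix p p' q q' :: gen_poly
  assume "sphere_eq p p'" "sphere_eq q q'"
  then have "q * (p - p') + p' * (q - q') \<in> sphere_ideal"
    unfolding sphere_eq_def by (intro sphere_ideal.add sphere_ideal.mult)
  then show "sphere_eq (p * q) (p' * q')"
    unfolding sphere_eq_def by (simp add: algebra_simps)
qed
instance
proof
  fix a b c :: OS3 and x y :: complex
  show "a + b + c = a + (b + c)" "a + b = b + a" "0 + a = a" "- a + a = 0" "a - b = a + - b"
    "a * b * c = a * (b * c)" "a * b = b * a" "1 * a = a" "(a + b) * c = a * c + b * c"
    by (transfer, simp add: sphere_eq_def sphere_ideal_0 algebra_simps)+
  show "x *\<^sub>C (a + b) = x *\<^sub>C a + x *\<^sub>C b" "(x + y) *\<^sub>C a = x *\<^sub>C a + y *\<^sub>C a"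
    "x *\<^sub>C y *\<^sub>C a = (x * y) *\<^sub>C a" "1 *\<^sub>C a = a" "(x *\<^sub>C a) * b = x *\<^sub>C (a * b)"
    by (transfer, simp add: sphere_eq_def sphere_ideal_0 scaleC_add_right scaleC_add_left
        scaleC_mult_left)+
  show "(0::OS3) \<noteq> 1"
  proof (transfer, rule notI)
    let ?f = "\<lambda>g. if g = Z1 \<or> g = Z1s then 1 else 0 :: complex"
    assume "sphere_eq 0 1"
    then have "poly_eval ?f (0 - 1) = 0"
      unfolding sphere_eq_def by (intro poly_eval_sphere_ideal) auto
    then show False by (simp only: poly_eval_diff poly_eval_1) (simp add: clinear_0[OF clinear_poly_eval])
  qed
qed
end

text \<open>\<open>sgen\<close> gives the classes of \<open>z\<^sub>1, z\<^sub>2, z\<^sub>1\<^sup>*, z\<^sub>2\<^sup>*\<close>.\<close>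

lift_definition sgen :: "gen \<Rightarrow> OS3" is gvar .

lift_definition sphere_star :: "OS3 \<Rightarrow> OS3" is poly_star
  unfolding sphere_eq_def by (drule sphere_ideal.star) (simp add: poly_star_diff)

lemma sphere_star_sgen: "sphere_star (sgen g) = sgen (gen_star g)"
  by transfer (simp add: poly_star_gvar sphere_eq_def sphere_ideal_0)

lemma sphere_relation: "sgen Z1s * sgen Z1 + sgen Z2s * sgen Z2 = 1"
  by transfer (simp add: sphere_eq_def sphere_ideal.relator flip: sphere_relator_def)

section \<open>The two coactions on the 3-sphere and the deformed product\<close>

fun circle_degree :: "gen \<Rightarrow> int" where
  "circle_degree Z1 = 1" | "circle_degree Z2 = 1" | "circle_degree Z1s = -1" | "circle_degree Z2s = -1"

fun torus_degree :: "gen \<Rightarrow> int \<times> int" where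
  "torus_degree Z1 = (1, 0)" | "torus_degree Z2 = (0, 1)"
| "torus_degree Z1s = (-1, 0)" | "torus_degree Z2s = (0, -1)"

lemma one_torus_index: "tpow (0, 0) = (1 :: OT2)"
  using tpow_0[where 'g = "int \<times> int"] by (simp add: zero_prod_def)

lift_definition coact_circle :: "OS3 \<Rightarrow> (OS3, OU1) tensor"
  is "poly_eval (\<lambda>g. sgen g \<otimes> tpow (circle_degree g))"
proof -
  let ?f = "\<lambda>g. sgen g \<otimes> tpow (circle_degree g)"
  fix p q assume "sphere_eq p q"
  moreover have "?f Z1s * ?f Z1 + ?f Z2s * ?f Z2 = 1"
    by (simp add: mult_tensor_tensor one_tensor_def tpow_0 sphere_relation
        flip: tpow_add tensor_add_left)
  ultimately have "poly_eval ?f (p - q) = 0"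
    unfolding sphere_eq_def by (intro poly_eval_sphere_ideal)
  then show "poly_eval ?f p = poly_eval ?f q" by (simp add: poly_eval_diff)
qed

lift_definition coact_torus :: "OS3 \<Rightarrow> (OT2, OS3) tensor"
  is "poly_eval (\<lambda>g. tpow (torus_degree g) \<otimes> sgen g)"
proof -
  let ?f = "\<lambda>g. tpow (torus_degree g) \<otimes> sgen g"
  fix p q assume "sphere_eq p q"
  moreover have "?f Z1s * ?f Z1 + ?f Z2s * ?f Z2 = 1"
    by (simp add: mult_tensor_tensor one_tensor_def one_torus_index sphere_relation plus_prod_def
        flip: tpow_add tensor_add_right)
  ultimately have "poly_eval ?f (p - q) = 0"
    unfolding sphere_eq_def by (intro poly_eval_sphere_ideal)
  then show "poly_eval ?f p = poly_eval ?f q" by (simp add: poly_eval_diff)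
qed

lemma coact_circle_sgen: "coact_circle (sgen g) = sgen g \<otimes> tpow (circle_degree g)"
  by transfer (rule poly_eval_gvar)

lemma coact_torus_sgen: "coact_torus (sgen g) = tpow (torus_degree g) \<otimes> sgen g"
  by transfer (rule poly_eval_gvar)

lemma coact_circle_mult: "coact_circle (a * b) = coact_circle a * coact_circle b"
  and coact_circle_1: "coact_circle 1 = 1"
  by (transfer, rule poly_eval_mult) (transfer, rule poly_eval_1)

lemma coact_torus_mult: "coact_torus (a * b) = coact_torus a * coact_torus b"
  and coact_torus_1: "coact_torus 1 = 1"
  by (transfer, rule poly_eval_mult) (transfer, rule poly_eval_1)

lemma clinear_coact_circle: "clinear coact_circle"
  by (rule clinearI; transfer) (simp_all add: poly_eval_add poly_eval_scale)

lemma clinear_coact_torus: "clinear coact_torus"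
  by (rule clinearI; transfer) (simp_all add: poly_eval_add poly_eval_scale)

definition bidegree_space :: "int \<times> int \<Rightarrow> int \<Rightarrow> OS3 set" where
  "bidegree_space m n = {a. coact_torus a = tpow m \<otimes> a \<and> coact_circle a = a \<otimes> tpow n}"

definition coinvariants :: "OS3 set" where
  "coinvariants = {b. coact_circle b = b \<otimes> 1}"

definition sigma :: "real \<Rightarrow> (OT2, OT2) tensor \<Rightarrow> complex" where
  "sigma \<theta> = tensor_lift (\<lambda>k k'. free_lift (\<lambda>m. free_lift (\<lambda>m'.
     exp (complex_of_real pi * \<i> * complex_of_real \<theta>
       * of_int (fst m * snd m' - snd m * fst m'))) k') k)"

lemma clinear_sigma: "clinear (sigma \<theta>)"
  unfolding sigma_def by (rule clinear_tensor_lift)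

lemma free_lift_cong_add: "free_lift (\<lambda>k. f k + g k) p = free_lift f p + free_lift g p"
  by (simp add: free_lift_def scaleC_add_right sum.distrib)

lemma free_lift_cong_scale: "free_lift (\<lambda>k. c *\<^sub>C f k) p = c *\<^sub>C free_lift f p"
  by (simp add: free_lift_def cs.scale_sum_right mult.commute)

lemma cbilinear_free_lift: "cbilinear (\<lambda>p q. free_lift (\<lambda>m. free_lift (f m) q) p)"
  by (rule cbilinearI)
    (simp_all add: clinear_add[OF clinear_free_lift] clinear_scale[OF clinear_free_lift]
      free_lift_cong_add free_lift_cong_scale)

lemma sigma_tpow:
  "sigma \<theta> (tpow m \<otimes> tpow m') =
     exp (complex_of_real pi * \<i> * complex_of_real \<theta> * of_int (fst m * snd m' - snd m * fst m'))"
  unfolding sigma_def tensor_lift_tensor[OF cbilinear_free_lift] by (simp add: tpow_def)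

definition star_prod :: "real \<Rightarrow> OS3 \<Rightarrow> OS3 \<Rightarrow> OS3" where
  "star_prod \<theta> a b =
     tensor_lift (\<lambda>k a\<^sub>0. tensor_lift (\<lambda>k' b\<^sub>0. sigma \<theta> (k \<otimes> k') *\<^sub>C (a\<^sub>0 * b\<^sub>0)) (coact_torus b)) (coact_torus a)"

lemma cbilinear_star_prod_inner:
  "cbilinear (\<lambda>k' b\<^sub>0. sigma \<theta> (k \<otimes> k') *\<^sub>C (a\<^sub>0 * b\<^sub>0))" for a\<^sub>0 :: OS3
  by (rule cbilinearI)
    (simp_all add: clinear_add[OF clinear_sigma] clinear_scale[OF clinear_sigma] tensor_simps
      scaleC_add_left scaleC_add_right distrib_left scaleC_mult_right scaleC_complex_def mult.commute)

lemma cbilinear_star_prod_outer: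
  "cbilinear (\<lambda>k a\<^sub>0. tensor_lift (\<lambda>k' b\<^sub>0. sigma \<theta> (k \<otimes> k') *\<^sub>C (a\<^sub>0 * b\<^sub>0)) y)"
  for y :: "(OT2, OS3) tensor"
proof (rule cbilinearI)
  fix k l :: OT2 and a b :: OS3 and c
  note bil = cbilinear_star_prod_inner[of \<theta>]
  let ?F = "\<lambda>k (a::OS3). tensor_lift (\<lambda>k' b\<^sub>0. sigma \<theta> (k \<otimes> k') *\<^sub>C (a * b\<^sub>0)) y"
  have s: "sigma \<theta> ((k + l) \<otimes> x) = sigma \<theta> (k \<otimes> x) + sigma \<theta> (l \<otimes> x)"
    "sigma \<theta> ((c *\<^sub>C k) \<otimes> x) = c * sigma \<theta> (k \<otimes> x)" for x
    by (simp_all add: clinear_add[OF clinear_sigma] clinear_scale[OF clinear_sigma] tensor_simps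
        scaleC_complex_def)
  show "?F (k + l) a = ?F k a + ?F l a"
    by (simp add: s scaleC_add_left tensor_lift_cong_add[OF bil bil])
  show "?F k (a + b) = ?F k a + ?F k b"
    by (simp add: distrib_right scaleC_add_right tensor_lift_cong_add[OF bil bil])
  show "?F (c *\<^sub>C k) a = c *\<^sub>C ?F k a"
    by (simp add: s flip: tensor_lift_cong_scale[OF bil])
  show "?F k (c *\<^sub>C a) = c *\<^sub>C ?F k a"
    using tensor_lift_cong_scale[OF bil[of k a], of c y]
    by (simp add: scaleC_mult_left mult.commute[of c])
qed

lemma cbilinear_star_prod: "cbilinear (star_prod \<theta>)"
proof (rule cbilinearI)
  fix a a' b b' :: OS3 and c
  note bil = cbilinear_star_prod_inner[of \<theta>]
  show "star_prod \<theta> (a + a') b = star_prod \<theta> a b + star_prod \<theta> a' b"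
    and "star_prod \<theta> (c *\<^sub>C a) b = c *\<^sub>C star_prod \<theta> a b"
    by (simp_all add: star_prod_def clinear_add[OF clinear_coact_torus]
        clinear_scale[OF clinear_coact_torus] tensor_lift_add tensor_lift_scale)
  show "star_prod \<theta> a (b + b') = star_prod \<theta> a b + star_prod \<theta> a b'"
    by (simp add: star_prod_def clinear_add[OF clinear_coact_torus] tensor_lift_add
        tensor_lift_cong_add[OF cbilinear_star_prod_outer cbilinear_star_prod_outer])
  show "star_prod \<theta> a (c *\<^sub>C b) = c *\<^sub>C star_prod \<theta> a b"
    by (simp add: star_prod_def clinear_scale[OF clinear_coact_torus] tensor_lift_scale
        tensor_lift_cong_scale[OF cbilinear_star_prod_outer])
qed

lemma star_prod_homogeneous:
  assumes "coact_torus a = tpow m \<otimes> a" "coact_torus b = tpow m' \<otimes> b"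
  shows "star_prod \<theta> a b = sigma \<theta> (tpow m \<otimes> tpow m') *\<^sub>C (a * b)"
  unfolding star_prod_def assms tensor_lift_tensor[OF cbilinear_star_prod_outer]
  by (rule tensor_lift_tensor[OF cbilinear_star_prod_inner])

section \<open>Associated modules and infinitesimal gauge transformations\<close>

text \<open>The cotensor product of \<open>OS3\<close> with a left comodule. It is the underlying vector space of both
  the classical and the deformed associated module; these differ only in the product used in
  \<open>module_act\<close> and \<open>gauge_act\<close> below: \<open>(*)\<close> classically, \<open>star_prod \<theta>\<close> in the deformed case.\<close>

definition cotensor :: "('v::complex_space \<Rightarrow> (OU1, 'v) tensor) \<Rightarrow> (OS3, 'v) tensor set" where
  "cotensor \<rho> =
     {s. tensor_assoc (tensor_map coact_circle (\<lambda>v. v) s) = tensor_map (\<lambda>a. a) \<rho> s}"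

definition module_act ::
    "(OS3 \<Rightarrow> OS3 \<Rightarrow> OS3) \<Rightarrow> OS3 \<Rightarrow> (OS3, 'v::complex_space) tensor \<Rightarrow> (OS3, 'v) tensor" where
  "module_act \<mu> b = tensor_map (\<mu> b) (\<lambda>v. v)"

typedef circle_der =
  "{D :: OU1 \<Rightarrow> complex. clinear D \<and> (\<forall>h k. D (h * k) = D h * counit k + counit h * D k)}"
  morphisms der_apply Abs_circle_der
  by (rule exI[of _ "\<lambda>_. 0"]) (auto intro: clinearI)

setup_lifting type_definition_circle_der

instantiation circle_der :: complex_space
begin
lift_definition zero_circle_der :: circle_der is "\<lambda>_. 0"
  by (auto intro: clinearI)
lift_definition plus_circle_der :: "circle_der \<Rightarrow> circle_der \<Rightarrow> circle_der" is "\<lambda>D E h. D h + E h"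
  by (auto intro!: clinearI simp: clinear_add clinear_scale scaleC_complex_def algebra_simps)
lift_definition minus_circle_der :: "circle_der \<Rightarrow> circle_der \<Rightarrow> circle_der" is "\<lambda>D E h. D h - E h"
  by (auto intro!: clinearI simp: clinear_add clinear_scale scaleC_complex_def algebra_simps)
lift_definition uminus_circle_der :: "circle_der \<Rightarrow> circle_der" is "\<lambda>D h. - D h"
  by (auto intro!: clinearI simp: clinear_add clinear_scale scaleC_complex_def algebra_simps)
lift_definition scaleC_circle_der :: "complex \<Rightarrow> circle_der \<Rightarrow> circle_der" is "\<lambda>c D h. c * D h"
  by (auto intro!: clinearI simp: clinear_add clinear_scale scaleC_complex_def algebra_simps)
instance
  by standard (transfer, simp add: algebra_simps)+
end

text \<open>The derivation \<open>t\<^sup>n \<mapsto> n\<close>, which spans \<open>circle_der\<close>.\<close>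

lift_definition circle_X :: circle_der is "free_lift complex_of_int"
proof (intro conjI allI)
  show "clinear (free_lift complex_of_int)" by (rule clinear_free_lift)
  note lin = clinear_add[OF clinear_free_lift]
  fix h k :: OU1
  show "free_lift complex_of_int (h * k) =
      free_lift complex_of_int h * counit k + counit h * free_lift complex_of_int k"
  proof (induction h rule: poly_mapping_add_induct)
    case (single n c)
    show ?case
      by (induction k rule: poly_mapping_add_induct)
        (simp_all add: mult_single counit_def scaleC_complex_def lin algebra_simps)
  qed (simp add: counit_def lin algebra_simps)
qed

lemma circle_X_tpow: "der_apply circle_X (tpow n) = of_int n"
  by (simp add: circle_X.rep_eq tpow_def scaleC_complex_def)

lemma circle_der_spanned: "\<exists>c. Y = c *\<^sub>C circle_X"
proof -
  have lin: "clinear (der_apply Y)"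
    and der: "der_apply Y (h * k) = der_apply Y h * counit k + counit h * der_apply Y k" for h k
    using der_apply[of Y] by auto
  let ?c = "der_apply Y (tpow 1)"
  have add: "der_apply Y (tpow (m + n)) = der_apply Y (tpow m) + der_apply Y (tpow n)" for m n
    by (simp add: tpow_add der counit_tpow)
  have "der_apply Y (tpow n) = ?c * of_int n" for n
  proof (induction n rule: int_induct[where k = 0])
    case base
    show ?case using add[of 0 0] by simp
  next
    case (step1 i)
    then show ?case using add[of i 1] by (simp add: algebra_simps)
  next
    case (step2 i)
    then show ?case using add[of "i - 1" 1] by (simp add: algebra_simps)
  qed
  note n = this
  have "der_apply Y h = der_apply (?c *\<^sub>C circle_X) h" for h
  proof (induction h rule: poly_mapping_add_induct)
    case (single k c)
    have "Poly_Mapping.single k c = c *\<^sub>C tpow k"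
      by (simp add: tpow_def scaleC_complex_def)
    then show ?case
      using n[of k] circle_X_tpow[of k] clinear_scale[OF lin, of c "tpow k"]
        clinear_scale[OF clinear_free_lift, of complex_of_int c "tpow k"]
      by (simp add: scaleC_circle_der.rep_eq circle_X.rep_eq scaleC_complex_def)
  next
    case (add p q)
    then show ?case
      by (simp add: clinear_add[OF lin] scaleC_circle_der.rep_eq circle_X.rep_eq
          clinear_add[OF clinear_free_lift] distrib_left)
  qed
  then have "Y = ?c *\<^sub>C circle_X"
    by (intro der_apply_inject[THEN iffD1] ext)
  then show ?thesis by blast
qed

definition trivial_coact :: "'v::complex_space \<Rightarrow> (OU1, 'v) tensor" where
  "trivial_coact v = 1 \<otimes> v"

definition der_act ::
    "('v::complex_space \<Rightarrow> (OU1, 'v) tensor) \<Rightarrow> circle_der \<Rightarrow> 'v \<Rightarrow> 'v" where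
  "der_act \<rho> Y v = tensor_lift (\<lambda>h w. der_apply Y h *\<^sub>C w) (\<rho> v)"

definition gauge_act ::
    "(OS3 \<Rightarrow> OS3 \<Rightarrow> OS3) \<Rightarrow> ('v::complex_space \<Rightarrow> (OU1, 'v) tensor) \<Rightarrow>
      (OS3, 'v) tensor \<Rightarrow> (OS3, circle_der) tensor \<Rightarrow> (OS3, 'v) tensor" where
  "gauge_act \<mu> \<rho> s \<zeta> = tensor_lift (\<lambda>a v. tensor_lift (\<lambda>b Y. \<mu> a b \<otimes> der_act \<rho> Y v) \<zeta>) s"

lemma cbilinear_der_act_arg: "cbilinear (\<lambda>h w. der_apply Y h *\<^sub>C w)"
  using der_apply[of Y]
  by (auto intro!: cbilinearI simp: clinear_add clinear_scale scaleC_add_left scaleC_add_right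
      scaleC_complex_def mult.commute)

lemma der_act_weight:
  assumes "v \<in> weight_space \<rho> n"
  shows "der_act \<rho> Y v = der_apply Y (tpow n) *\<^sub>C v"
  using assms by (simp add: der_act_def weight_space_def tensor_lift_tensor cbilinear_der_act_arg)

lemma cbilinear_der_act:
  assumes "clinear \<rho>"
  shows "cbilinear (der_act \<rho>)"
proof (rule cbilinearI)
  fix Y Y' :: circle_der and v v' c
  note bil = cbilinear_der_act_arg
  show "der_act \<rho> (Y + Y') v = der_act \<rho> Y v + der_act \<rho> Y' v"
    by (simp add: der_act_def plus_circle_der.rep_eq scaleC_add_left flip: tensor_lift_cong_add[OF bil bil])
  show "der_act \<rho> (c *\<^sub>C Y) v = c *\<^sub>C der_act \<rho> Y v"
    by (simp add: der_act_def scaleC_circle_der.rep_eq flip: tensor_lift_cong_scale[OF bil])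
  show "der_act \<rho> Y (v + v') = der_act \<rho> Y v + der_act \<rho> Y v'"
    and "der_act \<rho> Y (c *\<^sub>C v) = c *\<^sub>C der_act \<rho> Y v"
    by (simp_all add: der_act_def clinear_add[OF assms] clinear_scale[OF assms] tensor_lift_add
        tensor_lift_scale)
qed

lemma gauge_act_tensor:
  assumes "cbilinear \<mu>" "clinear \<rho>"
  shows "gauge_act \<mu> \<rho> (a \<otimes> v) (b \<otimes> Y) = \<mu> a b \<otimes> der_act \<rho> Y v"
proof -
  note D = cbilinearD[OF cbilinear_der_act[OF assms(2)]] and M = cbilinearD[OF assms(1)]
  have bil: "cbilinear (\<lambda>b Y. \<mu> a b \<otimes> der_act \<rho> Y v)" for a v
    by (rule cbilinearI) (simp_all add: D M tensor_simps)
  have bil': "cbilinear (\<lambda>a v. tensor_lift (\<lambda>b Y. \<mu> a b \<otimes> der_act \<rho> Y v) \<zeta>)" for \<zeta>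
    by (rule cbilinearI)
      (simp_all add: D M tensor_simps tensor_lift_cong_add[OF bil bil] tensor_lift_cong_scale[OF bil])
  show ?thesis
    unfolding gauge_act_def tensor_lift_tensor[OF bil'] by (rule tensor_lift_tensor[OF bil])
qed

text \<open>Homogeneous tensors span \<open>cotensor \<rho>\<close>, so this determines \<open>L\<close> on \<open>cotensor \<rho>\<close>;
  the values of \<open>L\<close> elsewhere are irrelevant.\<close>

definition is_L_map ::
    "real \<Rightarrow> ('v::complex_space \<Rightarrow> (OU1, 'v) tensor) \<Rightarrow> ((OS3, 'v) tensor \<Rightarrow> (OS3, 'v) tensor) \<Rightarrow> bool" where
  "is_L_map \<theta> \<rho> L \<longleftrightarrow>
     (\<forall>s \<in> cotensor \<rho>. \<forall>s' \<in> cotensor \<rho>. L (s + s') = L s + L s') \<and>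
     (\<forall>c. \<forall>s \<in> cotensor \<rho>. L (c *\<^sub>C s) = c *\<^sub>C L s) \<and>
     (\<forall>m n. \<forall>a \<in> bidegree_space (m + n, - m) n. \<forall>v \<in> weight_space \<rho> n.
        L (a \<otimes> v) = exp (complex_of_real pi * \<i> * complex_of_real \<theta> * of_int (m * n)) *\<^sub>C a \<otimes> v)"

lemma ex_is_L_map: "\<exists>L. is_L_map \<theta> \<rho> L"
proof -
  define \<tau> :: "OT2 \<Rightarrow> complex" where
    "\<tau> = free_lift (\<lambda>m. exp (complex_of_real pi * \<i> * complex_of_real \<theta>
        * of_int (- snd m * (fst m + snd m))))"
  define \<Lambda> :: "OS3 \<Rightarrow> OS3" where "\<Lambda> a = tensor_lift (\<lambda>k a\<^sub>0. \<tau> k *\<^sub>C a\<^sub>0) (coact_torus a)" for a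
  have lin\<tau>: "clinear \<tau>" unfolding \<tau>_def by (rule clinear_free_lift)
  have bil: "cbilinear (\<lambda>k (a\<^sub>0::OS3). \<tau> k *\<^sub>C a\<^sub>0)"
    by (rule cbilinearI)
      (simp_all add: clinear_add[OF lin\<tau>] clinear_scale[OF lin\<tau>] scaleC_add_left scaleC_add_right
        scaleC_complex_def mult.commute)
  have lin: "clinear \<Lambda>"
    unfolding \<Lambda>_def by (rule clinear_comp[OF clinear_tensor_lift clinear_coact_torus])
  have "is_L_map \<theta> \<rho> (tensor_map \<Lambda> (\<lambda>v. v))"
    unfolding is_L_map_def
  proof (intro conjI allI ballI)
    fix m n a v
    assume a: "a \<in> bidegree_space (m + n, - m) n"
    have "\<tau> (tpow (m + n, - m)) = exp (complex_of_real pi * \<i> * complex_of_real \<theta> * of_int (m * n))"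
      by (simp add: \<tau>_def tpow_def)
    then have "\<Lambda> a = exp (complex_of_real pi * \<i> * complex_of_real \<theta> * of_int (m * n)) *\<^sub>C a"
      using a by (simp add: \<Lambda>_def bidegree_space_def tensor_lift_tensor[OF bil])
    then show "tensor_map \<Lambda> (\<lambda>v. v) (a \<otimes> v) =
        exp (complex_of_real pi * \<i> * complex_of_real \<theta> * of_int (m * n)) *\<^sub>C a \<otimes> v"
      by (simp add: tensor_map_tensor[OF lin clinear_ident] tensor_scale_left)
  qed (simp_all add: clinear_add[OF clinear_tensor_map] clinear_scale[OF clinear_tensor_map])
  then show ?thesis by blast
qed

definition is_module_iso ::
    "real \<Rightarrow> ('v::complex_space \<Rightarrow> (OU1, 'v) tensor) \<Rightarrow> ((OS3, 'v) tensor \<Rightarrow> (OS3, 'v) tensor) \<Rightarrow> bool" where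
  "is_module_iso \<theta> \<rho> L \<longleftrightarrow>
     bij_betw L (cotensor \<rho>) (cotensor \<rho>) \<and>
     (\<forall>s \<in> cotensor \<rho>. \<forall>s' \<in> cotensor \<rho>. L (s + s') = L s + L s') \<and>
     (\<forall>c. \<forall>s \<in> cotensor \<rho>. L (c *\<^sub>C s) = c *\<^sub>C L s) \<and>
     (\<forall>b \<in> coinvariants. \<forall>s \<in> cotensor \<rho>.
        L (module_act (*) b s) = module_act (star_prod \<theta>) b (L s))"

definition intertwines_gauge ::
    "real \<Rightarrow> ('v::complex_space \<Rightarrow> (OU1, 'v) tensor) \<Rightarrow> ((OS3, 'v) tensor \<Rightarrow> (OS3, 'v) tensor) \<Rightarrow> bool" where
  "intertwines_gauge \<theta> \<rho> L \<longleftrightarrow>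
     (\<forall>s \<in> cotensor \<rho>. \<forall>\<zeta> \<in> cotensor trivial_coact.
        L (gauge_act (*) \<rho> s \<zeta>) = gauge_act (star_prod \<theta>) \<rho> (L s) \<zeta>)"

end

theory Submission
  imports Defs
begin

text \<open>Both tensor factors decompose into weight spaces, and comparing the two weight projections
  shows that the cotensor product is spanned by homogeneous tensors. On it \<open>L\<close> therefore agrees with
  \<open>\<Lambda>\<^sub>\<theta> \<otimes> id\<close>, where \<open>\<Lambda>\<^sub>\<theta>\<close> is the diagonal operator on the torus grading of the sphere; its inverse
  is \<open>\<Lambda>\<^sub>-\<^sub>\<theta>\<close>, and it carries left multiplication by a coinvariant to its deformed counterpart.
  A gauge transformation multiplies on the right instead, so the deformation phase enters with the
  opposite sign. On weight \<open>n\<close> the two sides differ by \<open>exp (2 \<pi> \<i> \<theta> n)\<close>, and for irrational \<open>\<theta>\<close> any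
  nonzero weight, which a non-trivial coaction must have, makes this differ from \<open>1\<close>.\<close>

section \<open>Weight decomposition of comodules\<close>

lemma cbilinear_lookup_scale_left: "cbilinear (\<lambda>h w. Poly_Mapping.lookup h n *\<^sub>C w)"
  and cbilinear_lookup_scale_right: "cbilinear (\<lambda>w h. Poly_Mapping.lookup h n *\<^sub>C w)"
  by (auto intro!: cbilinearI
      simp: lookup_add scaleC_add_left scaleC_add_right scaleC_complex_def mult.commute)

text \<open>Contraction with the functional dual to the basis element \<open>tpow n\<close>.
  Composed with a left coaction it becomes the projection onto weight \<open>n\<close>.\<close>

definition left_coeff :: "'g \<Rightarrow> ('g \<Rightarrow>\<^sub>0 complex, 'v::complex_space) tensor \<Rightarrow> 'v" where
  "left_coeff n = tensor_lift (\<lambda>h w. Poly_Mapping.lookup h n *\<^sub>C w)"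

definition right_coeff :: "'g \<Rightarrow> ('v::complex_space, 'g \<Rightarrow>\<^sub>0 complex) tensor \<Rightarrow> 'v" where
  "right_coeff n = tensor_lift (\<lambda>w h. Poly_Mapping.lookup h n *\<^sub>C w)"

lemma clinear_left_coeff: "clinear (left_coeff n)"
  and clinear_right_coeff: "clinear (right_coeff n)"
  by (simp_all add: left_coeff_def right_coeff_def clinear_tensor_lift)

lemma left_coeff_tensor [simp]: "left_coeff n (h \<otimes> w) = Poly_Mapping.lookup h n *\<^sub>C w"
  and right_coeff_tensor [simp]: "right_coeff n (w \<otimes> h) = Poly_Mapping.lookup h n *\<^sub>C w"
  by (simp_all add: left_coeff_def right_coeff_def tensor_lift_tensor
      cbilinear_lookup_scale_left cbilinear_lookup_scale_right)

lemma lookup_tpow: "Poly_Mapping.lookup (tpow g) h = (if g = h then 1 else 0)"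
  by (simp add: tpow_def lookup_single when_def)

text \<open>The scalar of a basis term can be moved into the second factor, so no separate scaling
  case is required.\<close>

lemma tensor_tpow_induct [case_names tpow add]:
  assumes tpow: "\<And>g w. P (tpow g \<otimes> w)"
    and add: "\<And>x y. P x \<Longrightarrow> P y \<Longrightarrow> P (x + y)"
  shows "P x"
proof (induction x)
  case (tensor h w)
  show ?case
  proof (induction h rule: poly_mapping_add_induct)
    case (single g c)
    have "Poly_Mapping.single g c = c *\<^sub>C tpow g" by (simp add: tpow_def scaleC_complex_def)
    then have "Poly_Mapping.single g c \<otimes> w = tpow g \<otimes> (c *\<^sub>C w)"
      by (simp add: tensor_simps)
    then show ?case by (simp add: tpow)
  qed (simp add: tensor_add_left add)
qed (rule add)

lemma tensor_coeff_expansion: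
  fixes x :: "('g \<Rightarrow>\<^sub>0 complex, 'v::complex_space) tensor"
  obtains S where "finite S" "x = (\<Sum>g\<in>S. tpow g \<otimes> left_coeff g x)"
proof -
  have zero: "tpow g \<otimes> (0::'v) = 0" for g :: 'g
    using tensor_scale_right[of "tpow g" 0 "0::'v"] by simp
  \<comment> \<open>Strengthened to all finite supersets of \<open>S\<close>, so that the expansions
    of two summands can be taken over the common index set \<open>S \<union> T\<close>.\<close>
  have "\<exists>S. finite S \<and> (\<forall>T. finite T \<longrightarrow> S \<subseteq> T \<longrightarrow> x = (\<Sum>g\<in>T. tpow g \<otimes> left_coeff g x))"
  proof (induction x rule: tensor_tpow_induct)
    case (tpow k w)
    have "tpow k \<otimes> w = (\<Sum>g\<in>T. tpow g \<otimes> left_coeff g (tpow k \<otimes> w))" if "finite T" "{k} \<subseteq> T" for T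
    proof -
      have "(\<Sum>g\<in>T. tpow g \<otimes> left_coeff g (tpow k \<otimes> w)) = (\<Sum>g\<in>T. if g = k then tpow k \<otimes> w else 0)"
        by (rule sum.cong) (auto simp: lookup_tpow zero)
      then show ?thesis using that by (simp add: sum.delta)
    qed
    then show ?case by blast
  next
    case (add x y)
    then obtain S T where S: "finite S" "\<forall>U. finite U \<longrightarrow> S \<subseteq> U \<longrightarrow> x = (\<Sum>g\<in>U. tpow g \<otimes> left_coeff g x)"
      and T: "finite T" "\<forall>U. finite U \<longrightarrow> T \<subseteq> U \<longrightarrow> y = (\<Sum>g\<in>U. tpow g \<otimes> left_coeff g y)"
      by blast
    have "x + y = (\<Sum>g\<in>U. tpow g \<otimes> left_coeff g (x + y))" if "finite U" "S \<union> T \<subseteq> U" for U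
    proof -
      have "x = (\<Sum>g\<in>U. tpow g \<otimes> left_coeff g x)" "y = (\<Sum>g\<in>U. tpow g \<otimes> left_coeff g y)"
        using S T that by auto
      then show ?thesis
        by (simp add: clinear_add[OF clinear_left_coeff] tensor_add_right sum.distrib)
    qed
    then show ?case using S(1) T(1) by (intro exI[of _ "S \<union> T"]) auto
  qed
  then show ?thesis using that by blast
qed

section \<open>Weight spaces of a left comodule\<close>

lemma left_comoduleD:
  assumes "left_comodule \<rho>"
  shows "clinear \<rho>"
    and "tensor_assoc (tensor_map comult (\<lambda>w. w) (\<rho> v)) = tensor_map (\<lambda>h. h) \<rho> (\<rho> v)"
    and "tensor_lift (\<lambda>h w. counit h *\<^sub>C w) (\<rho> v) = v"
  using assms by (auto simp: left_comodule_def)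

lemma clinear_comult: "clinear comult"
  and clinear_counit: "clinear counit"
  by (simp_all add: comult_def counit_def clinear_free_lift)

text \<open>Contract the first leg of the coassociativity identity with the functional dual to
  \<open>tpow n\<close>. One side becomes the coaction of the coefficient; on the other,
  \<open>comult\<close> is diagonal on the basis, which leaves \<open>tpow n\<close> in front of the
  same coefficient.\<close>

lemma left_coeff_coact_in_weight_space:
  assumes "left_comodule \<rho>"
  shows "left_coeff n (\<rho> v) \<in> weight_space \<rho> n"
proof -
  note lin = left_comoduleD(1)[OF assms]
  have "left_coeff n (tensor_map (\<lambda>h. h) \<rho> x) = \<rho> (left_coeff n x)" for x
    by (rule tensor_eqI)
      (simp_all add: clinear_comp clinear_left_coeff clinear_tensor_map lin tensor_map_tensor
        clinear_ident clinear_scale)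
  moreover have "left_coeff n (tensor_assoc (tensor_map comult (\<lambda>w. w) x)) = tpow n \<otimes> left_coeff n x"
    for x :: "(OU1, 'a) tensor"
  proof (induction x rule: tensor_tpow_induct)
    case (tpow g w)
    then show ?case
      using tensor_scale_right[of "tpow n" 0 "0::'a"]
      by (simp add: tensor_map_tensor clinear_comult clinear_ident comult_tpow tensor_assoc_tensor
          lookup_tpow)
  next
    case (add x y)
    then show ?case
      by (simp add: clinear_add[OF clinear_left_coeff] clinear_add[OF clinear_tensor_assoc]
          clinear_add[OF clinear_tensor_map] tensor_add_right)
  qed
  ultimately have "\<rho> (left_coeff n (\<rho> v)) = tpow n \<otimes> left_coeff n (\<rho> v)"
    using left_comoduleD(2)[OF assms, of v] by metis
  then show ?thesis by (simp add: weight_space_def)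
qed

text \<open>Apply the counit axiom to the expansion of \<open>\<rho> v\<close>: every
  \<open>tpow g\<close> is sent to 1, so only the coefficients remain.\<close>

lemma left_comodule_weight_decomposition:
  assumes "left_comodule \<rho>"
  obtains S where "finite S" "v = (\<Sum>n\<in>S. left_coeff n (\<rho> v))"
proof -
  obtain S where S: "finite S" "\<rho> v = (\<Sum>g\<in>S. tpow g \<otimes> left_coeff g (\<rho> v))"
    by (rule tensor_coeff_expansion)
  have bil: "cbilinear (\<lambda>h w. counit h *\<^sub>C (w::'a))"
    by (auto intro!: cbilinearI simp: clinear_add[OF clinear_counit] clinear_scale[OF clinear_counit]
        scaleC_add_left scaleC_add_right scaleC_complex_def mult.commute)
  have "v = tensor_lift (\<lambda>h w. counit h *\<^sub>C w) (\<Sum>g\<in>S. tpow g \<otimes> left_coeff g (\<rho> v))"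
    using left_comoduleD(3)[OF assms, of v] S(2) by simp
  also have "\<dots> = (\<Sum>g\<in>S. left_coeff g (\<rho> v))"
    by (simp add: csp.linear_sum[OF clinear_tensor_lift] tensor_lift_tensor[OF bil] counit_tpow)
  finally show ?thesis using S(1) that by blast
qed

lemma span_weight_spaces:
  assumes "left_comodule \<rho>"
  shows "v \<in> cs.span (\<Union>n. weight_space \<rho> n)"
proof -
  obtain S where S: "v = (\<Sum>n\<in>S. left_coeff n (\<rho> v))"
    using left_comodule_weight_decomposition[OF assms] by metis
  have "(\<Sum>n\<in>S. left_coeff n (\<rho> v)) \<in> cs.span (\<Union>n. weight_space \<rho> n)"
    using left_coeff_coact_in_weight_space[OF assms] by (intro cs.span_sum cs.span_base) blast
  then show ?thesis using S by simp
qed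

lemma left_coeff_weight:
  assumes "v \<in> weight_space \<rho> k"
  shows "left_coeff n (\<rho> v) = (if k = n then v else 0)"
  using assms by (simp add: weight_space_def lookup_tpow)

text \<open>If all weight spaces of nonzero weight vanished, the weight-zero vectors would span, and
  on those the coaction is trivial because \<open>tpow 0 = 1\<close>.\<close>

lemma exists_nonzero_weight:
  assumes "left_comodule \<rho>" "\<exists>v. \<rho> v \<noteq> 1 \<otimes> v"
  obtains n v where "n \<noteq> 0" "v \<in> weight_space \<rho> n" "v \<noteq> 0"
proof (rule ccontr)
  assume "\<not> thesis"
  then have zero: "v = 0" if "v \<in> weight_space \<rho> n" "n \<noteq> 0" for n v
    using that \<open>\<And>n v. n \<noteq> 0 \<Longrightarrow> v \<in> weight_space \<rho> n \<Longrightarrow> v \<noteq> 0 \<Longrightarrow> thesis\<close> by blast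
  note lin = left_comoduleD(1)[OF assms(1)]
  have triv: "\<rho> 0 = 1 \<otimes> 0"
    using tensor_scale_right[of 1 0 0] by (simp add: clinear_0[OF lin])
  have "\<rho> v = 1 \<otimes> v" for v
    using span_weight_spaces[OF assms(1), of v]
  proof (induction rule: cs.span_induct_alt)
    case base
    show ?case by (rule triv)
  next
    case (step c x y)
    then obtain n where n: "x \<in> weight_space \<rho> n" by blast
    have "\<rho> x = 1 \<otimes> x"
      using zero[OF n] n triv by (cases "n = 0") (auto simp: weight_space_def tpow_0)
    then show ?case
      using step by (simp add: clinear_add[OF lin] clinear_scale[OF lin] tensor_simps)
  qed
  then show False using assms(2) by blast
qed

section \<open>Bigrading of the 3-sphere\<close>

lemma bidegree_space_1: "1 \<in> bidegree_space 0 0"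
  by (simp add: bidegree_space_def coact_torus_1 coact_circle_1 tpow_0 one_tensor_def)

lemma bidegree_space_mult:
  assumes "a \<in> bidegree_space k n" "b \<in> bidegree_space k' n'"
  shows "a * b \<in> bidegree_space (k + k') (n + n')"
  using assms
  by (simp add: bidegree_space_def coact_torus_mult coact_circle_mult mult_tensor_tensor tpow_add)

lemma bidegree_space_power:
  assumes "a \<in> bidegree_space (p, 0) q"
  shows "a ^ n \<in> bidegree_space (int n * p, 0) (int n * q)"
proof (induction n)
  case 0
  then show ?case using bidegree_space_1 by (simp add: zero_prod_def)
next
  case (Suc n)
  then show ?case using bidegree_space_mult[OF assms Suc] by (simp add: algebra_simps)
qed

lemma sgen_bidegree: "sgen g \<in> bidegree_space (torus_degree g) (circle_degree g)"
  by (simp add: bidegree_space_def coact_torus_sgen coact_circle_sgen)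

text \<open>Torus degrees whose entries add up to the circle degree suffice to span the sphere
  algebra: every generator has this property and products preserve it.\<close>

definition homogeneous_elements :: "OS3 set" where
  "homogeneous_elements = (\<Union>m n. bidegree_space (m + n, - m) n)"

lemma homogeneous_elements_mult:
  assumes "a \<in> homogeneous_elements" "b \<in> homogeneous_elements"
  shows "a * b \<in> homogeneous_elements"
proof -
  obtain m n m' n' where "a \<in> bidegree_space (m + n, - m) n" "b \<in> bidegree_space (m' + n', - m') n'"
    using assms by (auto simp: homogeneous_elements_def)
  from bidegree_space_mult[OF this]
  have "a * b \<in> bidegree_space ((m + m') + (n + n'), - (m + m')) (n + n')"
    by (simp add: algebra_simps)
  then show ?thesis unfolding homogeneous_elements_def by blast
qed

lemma sgen_homogeneous: "sgen g \<in> homogeneous_elements"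
proof -
  have "torus_degree g = (- snd (torus_degree g) + circle_degree g, - (- snd (torus_degree g)))"
    by (cases g) simp_all
  with sgen_bidegree[of g] have "sgen g \<in> bidegree_space
      (- snd (torus_degree g) + circle_degree g, - (- snd (torus_degree g))) (circle_degree g)"
    by metis
  then show ?thesis unfolding homogeneous_elements_def by blast
qed

text \<open>The induction runs over the exponent vector \<open>k\<close>, itself a finitely
  supported map: adding exponent vectors multiplies monomials.\<close>

lemma monomial_homogeneous: "abs_OS3 (Poly_Mapping.single k 1) \<in> homogeneous_elements"
proof (induction k rule: poly_mapping_add_induct)
  case (single g n)
  show ?case
  proof (induction n)
    case 0
    have "bidegree_space 0 0 \<subseteq> homogeneous_elements"
      unfolding homogeneous_elements_def by (intro subsetI UN_I[of 0]) (auto simp: zero_prod_def)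
    then have "1 \<in> homogeneous_elements" using bidegree_space_1 by blast
    then show ?case by (simp add: one_OS3.abs_eq[symmetric])
  next
    case (Suc n)
    have "Poly_Mapping.single (Poly_Mapping.single g (Suc n)) (1::complex) =
        gvar g * Poly_Mapping.single (Poly_Mapping.single g n) 1"
      by (simp add: gvar_def mult_single flip: single_add)
    then have "abs_OS3 (Poly_Mapping.single (Poly_Mapping.single g (Suc n)) 1) =
        sgen g * abs_OS3 (Poly_Mapping.single (Poly_Mapping.single g n) 1)"
      by (simp add: sgen.abs_eq times_OS3.abs_eq)
    then show ?case using homogeneous_elements_mult[OF sgen_homogeneous Suc] by simp
  qed
next
  case (add k l)
  have "abs_OS3 (Poly_Mapping.single (k + l) 1) =
      abs_OS3 (Poly_Mapping.single k 1) * abs_OS3 (Poly_Mapping.single l 1)"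
    by (simp add: times_OS3.abs_eq mult_single)
  then show ?case using homogeneous_elements_mult[OF add] by simp
qed

lemma span_homogeneous_elements: "a \<in> cs.span homogeneous_elements"
proof -
  have "abs_OS3 p \<in> cs.span homogeneous_elements" for p
  proof (induction p rule: poly_mapping_add_induct)
    case (single k c)
    have "abs_OS3 (Poly_Mapping.single k c) = c *\<^sub>C abs_OS3 (Poly_Mapping.single k 1)"
      by (simp add: scaleC_OS3.abs_eq scaleC_complex_def)
    then show ?case by (simp add: cs.span_scale cs.span_base monomial_homogeneous)
  next
    case (add p q)
    then show ?case by (simp add: cs.span_add flip: plus_OS3.abs_eq)
  qed
  then show ?thesis by (induct a rule: OS3.abs_induct) blast
qed

lemma clinear_eqI_homogeneous:
  assumes "clinear f" "clinear g"
    and "\<And>m n a. a \<in> bidegree_space (m + n, - m) n \<Longrightarrow> f a = g a"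
  shows "f a = g a"
  using span_homogeneous_elements[of a]
proof (induction rule: cs.span_induct_alt)
  case base
  show ?case by (simp add: clinear_0 assms)
next
  case (step c x y)
  then show ?case using assms(3)
    by (auto simp: clinear_add[OF assms(1)] clinear_add[OF assms(2)] clinear_scale[OF assms(1)]
        clinear_scale[OF assms(2)] homogeneous_elements_def)
qed

lemma right_coeff_coact_circle:
  assumes "coact_circle a = a \<otimes> tpow k"
  shows "right_coeff n (coact_circle a) = (if k = n then a else 0)"
  using assms by (simp add: lookup_tpow)

text \<open>The projection onto circle weight 0 fixes \<open>b\<close>. On a homogeneous element it
  is zero unless \<open>n = 0\<close>, and then the torus degree has the form
  \<open>(m, - m)\<close>.\<close>

lemma coinvariants_span:
  assumes "b \<in> coinvariants"
  shows "b \<in> cs.span (\<Union>k. bidegree_space (k, - k) 0)"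
proof -
  let ?B = "\<Union>k. bidegree_space (k, - k) 0"
  note lin = clinear_comp[OF clinear_right_coeff clinear_coact_circle, of 0]
  have "right_coeff 0 (coact_circle a) \<in> cs.span ?B" for a
    using span_homogeneous_elements[of a]
  proof (induction rule: cs.span_induct_alt)
    case base
    show ?case by (simp add: clinear_0[OF lin] cs.span_zero)
  next
    case (step c x y)
    then obtain m n where x: "x \<in> bidegree_space (m + n, - m) n"
      by (auto simp: homogeneous_elements_def)
    have "right_coeff 0 (coact_circle x) = (if n = 0 then x else 0)"
      using x by (intro right_coeff_coact_circle) (simp add: bidegree_space_def)
    moreover have "x \<in> ?B" if "n = 0" using x that by auto
    ultimately have "right_coeff 0 (coact_circle x) \<in> cs.span ?B"
      by (simp add: cs.span_base cs.span_zero)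
    then show ?case
      using step by (simp add: clinear_add[OF lin] clinear_scale[OF lin] cs.span_add cs.span_scale)
  qed
  moreover have "right_coeff 0 (coact_circle b) = b"
    using assms right_coeff_coact_circle[of b 0 0] by (simp add: coinvariants_def tpow_0)
  ultimately show ?thesis by metis
qed

section \<open>Homogeneous tensors span the cotensor product\<close>

definition homogeneous_tensors :: "('v::complex_space \<Rightarrow> (OU1, 'v) tensor) \<Rightarrow> (OS3, 'v) tensor set" where
  "homogeneous_tensors \<rho> =
     {a \<otimes> v | a v m n. a \<in> bidegree_space (m + n, - m) n \<and> v \<in> weight_space \<rho> n}"

lemma subspace_cotensor: "cs.subspace (cotensor \<rho>)"
  by (rule cs.subspaceI)
    (simp_all add: cotensor_def clinear_0[OF clinear_tensor_assoc] clinear_0[OF clinear_tensor_map]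
      clinear_add[OF clinear_tensor_assoc] clinear_add[OF clinear_tensor_map]
      clinear_scale[OF clinear_tensor_assoc] clinear_scale[OF clinear_tensor_map])

lemma tensor_in_cotensor:
  assumes "clinear \<rho>" "coact_circle a = a \<otimes> tpow n" "v \<in> weight_space \<rho> n"
  shows "a \<otimes> v \<in> cotensor \<rho>"
  using assms
  by (simp add: cotensor_def tensor_map_tensor clinear_coact_circle clinear_ident
      tensor_assoc_tensor weight_space_def)

text \<open>Contract the middle leg of the defining equation of the cotensor product with the
  functional dual to \<open>tpow n\<close>.\<close>

lemma cotensor_coeff_eq:
  assumes "clinear \<rho>" "s \<in> cotensor \<rho>"
  shows "tensor_map (\<lambda>a. right_coeff n (coact_circle a)) (\<lambda>v. v) s =
    tensor_map (\<lambda>a. a) (\<lambda>v. left_coeff n (\<rho> v)) s"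
proof -
  let ?G = "tensor_map (\<lambda>a. a) (left_coeff n)"
  note lins = clinear_left_coeff clinear_right_coeff clinear_tensor_map clinear_ident
    clinear_coact_circle clinear_tensor_assoc assms(1)
  have *: "?G (tensor_assoc (x \<otimes> v)) = right_coeff n x \<otimes> v" for x :: "(OS3, OU1) tensor" and v :: 'a
    by (induction x)
      (simp_all add: tensor_assoc_tensor tensor_map_tensor lins tensor_simps clinear_add[OF clinear_tensor_assoc]
        clinear_add[OF clinear_tensor_map] clinear_add[OF clinear_right_coeff])
  have "tensor_map (\<lambda>a. right_coeff n (coact_circle a)) (\<lambda>v. v) s =
      ?G (tensor_assoc (tensor_map coact_circle (\<lambda>v. v) s))"
    by (rule tensor_eqI)
      (simp_all add: lins clinear_comp[OF clinear_tensor_map] clinear_comp[OF clinear_tensor_assoc]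
        clinear_comp[OF clinear_right_coeff] tensor_map_tensor *)
  also have "\<dots> = ?G (tensor_map (\<lambda>a. a) \<rho> s)"
    using assms(2) by (simp add: cotensor_def)
  also have "\<dots> = tensor_map (\<lambda>a. a) (\<lambda>v. left_coeff n (\<rho> v)) s"
    by (rule tensor_eqI)
      (simp_all add: lins clinear_comp[OF clinear_tensor_map] clinear_comp[OF clinear_left_coeff]
        tensor_map_tensor)
  finally show ?thesis .
qed

lemma tensor_map_weight_decomposition:
  fixes s :: "(OS3, 'v::complex_space) tensor"
  assumes "left_comodule \<rho>"
  obtains S where "finite S" "s = (\<Sum>n\<in>S. tensor_map (\<lambda>a. a) (\<lambda>v. left_coeff n (\<rho> v)) s)"
proof -
  note lin = left_comoduleD(1)[OF assms]
  let ?Q = "\<lambda>n. tensor_map (\<lambda>a::OS3. a) (\<lambda>v. left_coeff n (\<rho> v))"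
  have Q: "?Q n (a \<otimes> v) = a \<otimes> left_coeff n (\<rho> v)" for n a v
    by (simp add: tensor_map_tensor clinear_ident clinear_comp[OF clinear_left_coeff lin])
  have "\<exists>S. finite S \<and> (\<forall>T. finite T \<longrightarrow> S \<subseteq> T \<longrightarrow> s = (\<Sum>n\<in>T. ?Q n s))"
  proof (induction s)
    case (tensor a v)
    show ?case
      using span_weight_spaces[OF assms, of v]
    proof (induction rule: cs.span_induct_alt)
      case base
      have "a \<otimes> (0::'v) = 0" using tensor_scale_right[of a 0 "0::'v"] by simp
      then show ?case by (intro exI[of _ "{}"]) (simp add: clinear_0[OF clinear_tensor_map])
    next
      case (step c x y)
      then obtain k S where k: "x \<in> weight_space \<rho> k"
        and S: "finite S" "\<forall>T. finite T \<longrightarrow> S \<subseteq> T \<longrightarrow> a \<otimes> y = (\<Sum>n\<in>T. ?Q n (a \<otimes> y))" by blast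
      have "a \<otimes> (c *\<^sub>C x + y) = (\<Sum>n\<in>T. ?Q n (a \<otimes> (c *\<^sub>C x + y)))" if "finite T" "insert k S \<subseteq> T" for T
      proof -
        have "a \<otimes> (0::'v) = 0" using tensor_scale_right[of a 0 "0::'v"] by simp
        then have "(\<Sum>n\<in>T. ?Q n (a \<otimes> x)) = (\<Sum>n\<in>T. if k = n then a \<otimes> x else 0)"
          by (intro sum.cong) (auto simp: Q left_coeff_weight[OF k])
        then have x: "(\<Sum>n\<in>T. ?Q n (a \<otimes> x)) = a \<otimes> x" using that by simp
        have y: "(\<Sum>n\<in>T. ?Q n (a \<otimes> y)) = a \<otimes> y" using S that by simp
        show ?thesis
          by (simp add: tensor_simps clinear_add[OF clinear_tensor_map] clinear_scale[OF clinear_tensor_map]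
              sum.distrib x y flip: cs.scale_sum_right)
      qed
      then show ?case using S(1) by (intro exI[of _ "insert k S"]) auto
    qed
  next
    case (add s t)
    then obtain S T where S: "finite S" "\<forall>U. finite U \<longrightarrow> S \<subseteq> U \<longrightarrow> s = (\<Sum>n\<in>U. ?Q n s)"
      and T: "finite T" "\<forall>U. finite U \<longrightarrow> T \<subseteq> U \<longrightarrow> t = (\<Sum>n\<in>U. ?Q n t)" by blast
    have "s + t = (\<Sum>n\<in>U. ?Q n (s + t))" if "finite U" "S \<union> T \<subseteq> U" for U
      using S T that by (simp add: clinear_add[OF clinear_tensor_map] sum.distrib)
    then show ?case using S(1) T(1) by (intro exI[of _ "S \<union> T"]) auto
  qed
  then show ?thesis using that by blast
qed

text \<open>For the harder inclusion, \<open>?Q n\<close> and \<open>?R n\<close> below project the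
  comodule leg and the sphere leg to weight \<open>n\<close>. They agree on the cotensor product, so
  each component \<open>?Q n s\<close> is homogeneous in both legs at once.\<close>

lemma cotensor_eq_span:
  assumes "left_comodule \<rho>"
  shows "cotensor \<rho> = cs.span (homogeneous_tensors \<rho>)"
proof
  note lin = left_comoduleD(1)[OF assms]
  show "cs.span (homogeneous_tensors \<rho>) \<subseteq> cotensor \<rho>"
  proof (rule cs.span_minimal[OF _ subspace_cotensor])
    show "homogeneous_tensors \<rho> \<subseteq> cotensor \<rho>"
      by (auto simp: homogeneous_tensors_def bidegree_space_def intro!: tensor_in_cotensor[OF lin])
  qed
  show "cotensor \<rho> \<subseteq> cs.span (homogeneous_tensors \<rho>)"
  proof
    fix s assume s: "s \<in> cotensor \<rho>"
    let ?Q = "\<lambda>n. tensor_map (\<lambda>a::OS3. a) (\<lambda>v. left_coeff n (\<rho> v))"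
    let ?R = "\<lambda>n. tensor_map (\<lambda>a. right_coeff n (coact_circle a)) (\<lambda>v. v)"
    have Q: "?Q n (a \<otimes> v) = a \<otimes> left_coeff n (\<rho> v)" for n a v
      by (simp add: tensor_map_tensor clinear_ident clinear_comp[OF clinear_left_coeff lin])
    have R: "?R n (a \<otimes> v) = right_coeff n (coact_circle a) \<otimes> v" for n a and v :: 'a
      by (simp add: tensor_map_tensor clinear_ident clinear_comp[OF clinear_right_coeff clinear_coact_circle])
    have idem: "?Q n (?Q n x) = ?Q n x" for n x
      by (induction x)
        (simp_all add: Q left_coeff_weight[OF left_coeff_coact_in_weight_space[OF assms]]
          clinear_add[OF clinear_tensor_map])
    \<comment> \<open>Valid for every tensor \<open>x\<close>: with both legs forced to weight
      \<open>n\<close>, only matching pairs survive.\<close>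
    have span: "?Q n (?R n x) \<in> cs.span (homogeneous_tensors \<rho>)" for n x
    proof (induction x)
      case (tensor a v)
      let ?w = "left_coeff n (\<rho> v)"
      have w: "?w \<in> weight_space \<rho> n" by (rule left_coeff_coact_in_weight_space[OF assms])
      note qlin = clinear_comp[OF clinear_right_coeff clinear_coact_circle, of n]
      have zero: "(0::OS3) \<otimes> ?w = 0" using tensor_scale_left[of 0 "0::OS3" ?w] by simp
      have "right_coeff n (coact_circle a) \<otimes> ?w \<in> cs.span (homogeneous_tensors \<rho>)"
        using span_homogeneous_elements[of a]
      proof (induction rule: cs.span_induct_alt)
        case base
        show ?case by (simp add: clinear_0[OF qlin] zero cs.span_zero)
      next
        case (step c x y)
        then obtain m k where x: "x \<in> bidegree_space (m + k, - m) k"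
          by (auto simp: homogeneous_elements_def)
        have "right_coeff n (coact_circle x) = (if k = n then x else 0)"
          using x by (intro right_coeff_coact_circle) (simp add: bidegree_space_def)
        moreover have "x \<otimes> ?w \<in> homogeneous_tensors \<rho>" if "k = n"
          using x w that unfolding homogeneous_tensors_def by blast
        ultimately have "right_coeff n (coact_circle x) \<otimes> ?w \<in> cs.span (homogeneous_tensors \<rho>)"
          by (simp add: cs.span_base cs.span_zero zero)
        then show ?case
          using step by (simp add: clinear_add[OF qlin] clinear_scale[OF qlin] tensor_simps
              cs.span_add cs.span_scale)
      qed
      then show ?case by (simp only: Q R)
    next
      case (add x y)
      then show ?case by (simp add: clinear_add[OF clinear_tensor_map] cs.span_add)
    qed
    obtain S where S: "s = (\<Sum>n\<in>S. ?Q n s)"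
      using tensor_map_weight_decomposition[OF assms] by metis
    \<comment> \<open>Since \<open>?R n s = ?Q n s\<close> for this \<open>s\<close>, idempotence
      turns \<open>?Q n (?R n s)\<close> into \<open>?Q n s\<close>.\<close>
    have "?Q n s \<in> cs.span (homogeneous_tensors \<rho>)" for n
      using span[of n s] cotensor_coeff_eq[OF lin s, of n] idem[of n s] by simp
    then have "(\<Sum>n\<in>S. ?Q n s) \<in> cs.span (homogeneous_tensors \<rho>)"
      by (intro cs.span_sum)
    then show "s \<in> cs.span (homogeneous_tensors \<rho>)" using S by simp
  qed
qed

section \<open>The phase map on the 3-sphere\<close>

abbreviation phase :: "real \<Rightarrow> int \<Rightarrow> complex" where
  "phase \<theta> k \<equiv> exp (complex_of_real pi * \<i> * complex_of_real \<theta> * of_int k)"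

lemma phase_add: "phase \<theta> (k + l) = phase \<theta> k * phase \<theta> l"
  by (simp add: distrib_left exp_add)

text \<open>On torus degree \<open>(m + n, - m)\<close> the index \<open>- snd k * (fst k + snd k)\<close> is \<open>m * n\<close>.\<close>

definition torus_phase :: "real \<Rightarrow> OS3 \<Rightarrow> OS3" where
  "torus_phase \<theta> a =
     tensor_lift (\<lambda>h a\<^sub>0. free_lift (\<lambda>k. phase \<theta> (- snd k * (fst k + snd k))) h *\<^sub>C a\<^sub>0) (coact_torus a)"

lemma clinear_torus_phase: "clinear (torus_phase \<theta>)"
  unfolding torus_phase_def by (rule clinear_comp[OF clinear_tensor_lift clinear_coact_torus])

lemma torus_phase_bidegree:
  assumes "a \<in> bidegree_space (m + n, - m) n"
  shows "torus_phase \<theta> a = phase \<theta> (m * n) *\<^sub>C a"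
proof -
  let ?\<tau> = "free_lift (\<lambda>k::int \<times> int. phase \<theta> (- snd k * (fst k + snd k)))"
  have bil: "cbilinear (\<lambda>h (a\<^sub>0::OS3). ?\<tau> h *\<^sub>C a\<^sub>0)"
    by (rule cbilinearI)
      (simp_all add: clinear_add[OF clinear_free_lift] clinear_scale[OF clinear_free_lift]
        scaleC_add_left scaleC_add_right scaleC_complex_def mult.commute)
  have "coact_torus a = tpow (m + n, - m) \<otimes> a" using assms by (simp add: bidegree_space_def)
  then have "torus_phase \<theta> a = ?\<tau> (tpow (m + n, - m)) *\<^sub>C a"
    unfolding torus_phase_def by (simp only: tensor_lift_tensor[OF bil])
  also have "?\<tau> (tpow (m + n, - m)) = phase \<theta> (m * n)"
    unfolding tpow_def free_lift_single by simp
  finally show ?thesis .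
qed

lemma torus_phase_uminus: "torus_phase (- \<theta>) (torus_phase \<theta> a) = a"
proof (rule clinear_eqI_homogeneous[OF clinear_comp[OF clinear_torus_phase clinear_torus_phase] clinear_ident])
  fix m n a assume a: "a \<in> bidegree_space (m + n, - m) n"
  show "torus_phase (- \<theta>) (torus_phase \<theta> a) = a"
    by (simp add: torus_phase_bidegree[OF a] clinear_scale[OF clinear_torus_phase] flip: exp_add)
qed

section \<open>The deformed product against the phase map\<close>

lemma star_prod_bidegree:
  assumes "a \<in> bidegree_space k n" "b \<in> bidegree_space k' n'"
  shows "star_prod \<theta> a b = phase \<theta> (fst k * snd k' - snd k * fst k') *\<^sub>C (a * b)"
  using assms star_prod_homogeneous[of a k b k' \<theta>] by (simp add: bidegree_space_def sigma_tpow)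

text \<open>A coinvariant of torus degree \<open>(k, - k)\<close> shifts \<open>m\<close> to
  \<open>k + m\<close>, which changes the phase exponent by \<open>k * n\<close>. The deformed
  product contributes the same exponent, \<open>k * (- m) + k * (m + n)\<close>.\<close>

lemma torus_phase_mult_coinvariant:
  assumes "b \<in> coinvariants"
  shows "torus_phase \<theta> (b * a) = star_prod \<theta> b (torus_phase \<theta> a)"
  using coinvariants_span[OF assms]
proof (induction rule: cs.span_induct_alt)
  case base
  show ?case
    using cbilinearD(3)[OF cbilinear_star_prod, of \<theta> 0 0] by (simp add: clinear_0[OF clinear_torus_phase])
next
  case (step c x y)
  then obtain k where x: "x \<in> bidegree_space (k, - k) 0" by blast
  have "torus_phase \<theta> (x * a) = star_prod \<theta> x (torus_phase \<theta> a)"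
  proof (rule clinear_eqI_homogeneous[where f = "\<lambda>a. torus_phase \<theta> (x * a)"
        and g = "\<lambda>a. star_prod \<theta> x (torus_phase \<theta> a)"])
    show "clinear (\<lambda>a. torus_phase \<theta> (x * a))"
      by (rule clinearI)
        (simp_all add: distrib_left scaleC_mult_right clinear_add[OF clinear_torus_phase]
          clinear_scale[OF clinear_torus_phase])
    show "clinear (\<lambda>a. star_prod \<theta> x (torus_phase \<theta> a))"
      by (rule clinearI)
        (simp_all add: clinear_add[OF clinear_torus_phase] clinear_scale[OF clinear_torus_phase]
          cbilinearD[OF cbilinear_star_prod])
    fix m n a assume a: "a \<in> bidegree_space (m + n, - m) n"
    have "x * a \<in> bidegree_space ((k + m) + n, - (k + m)) n"
      using bidegree_space_mult[OF x a] by (simp add: algebra_simps)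
    then have "torus_phase \<theta> (x * a) = phase \<theta> ((k + m) * n) *\<^sub>C (x * a)"
      by (rule torus_phase_bidegree)
    also have "\<dots> = phase \<theta> (m * n) *\<^sub>C phase \<theta> (k * n) *\<^sub>C (x * a)"
      by (simp only: scaleC_scaleC phase_add[symmetric]) (simp add: algebra_simps)
    also have "phase \<theta> (k * n) *\<^sub>C (x * a) = star_prod \<theta> x a"
      unfolding star_prod_bidegree[OF x a] by (simp add: algebra_simps)
    also have "phase \<theta> (m * n) *\<^sub>C star_prod \<theta> x a = star_prod \<theta> x (torus_phase \<theta> a)"
      by (simp only: torus_phase_bidegree[OF a] cbilinearD[OF cbilinear_star_prod])
    finally show "torus_phase \<theta> (x * a) = star_prod \<theta> x (torus_phase \<theta> a)" .
  qed
  then show ?case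
    using step by (simp add: distrib_right scaleC_mult_left clinear_add[OF clinear_torus_phase]
        clinear_scale[OF clinear_torus_phase] cbilinearD[OF cbilinear_star_prod])
qed

section \<open>The module isomorphism\<close>

lemma tensor_map_torus_phase_tensor:
  "tensor_map (torus_phase \<theta>) (\<lambda>v. v) (a \<otimes> v) = torus_phase \<theta> a \<otimes> v"
  by (rule tensor_map_tensor[OF clinear_torus_phase clinear_ident])

text \<open>The right-hand side is linear on the whole tensor product, so later identities can be
  checked on pure tensors that need not lie in the cotensor product.\<close>

lemma is_L_map_eq_tensor_map:
  assumes "left_comodule \<rho>" "is_L_map \<theta> \<rho> L" "s \<in> cotensor \<rho>"
  shows "L s = tensor_map (torus_phase \<theta>) (\<lambda>v. v) s"
proof -
  let ?T = "tensor_map (torus_phase \<theta>) (\<lambda>v::'a. v)"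
  note span = cotensor_eq_span[OF assms(1)]
  have add: "L (x + y) = L x + L y" and scale: "L (c *\<^sub>C x) = c *\<^sub>C L x"
    if "x \<in> cotensor \<rho>" "y \<in> cotensor \<rho>" for x y c
    using assms(2) that unfolding is_L_map_def by blast+
  have hom: "L (a \<otimes> v) = phase \<theta> (m * n) *\<^sub>C a \<otimes> v"
    if "a \<in> bidegree_space (m + n, - m) n" "v \<in> weight_space \<rho> n" for a v m n
    using assms(2) that unfolding is_L_map_def by blast
  have "s \<in> cs.span (homogeneous_tensors \<rho>)" using assms(3) span by simp
  \<comment> \<open>Membership is carried along because linearity of \<open>L\<close> is only given
    on \<open>cotensor \<rho>\<close>.\<close>
  then have "s \<in> cotensor \<rho> \<and> L s = ?T s"
  proof (induction rule: cs.span_induct_alt)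
    case base
    have 0: "0 \<in> cotensor \<rho>" by (rule cs.subspace_0[OF subspace_cotensor])
    then show ?case using scale[OF 0 0, of 0] by (simp add: clinear_0[OF clinear_tensor_map])
  next
    case (step c x y)
    then obtain a v m n where x: "x = a \<otimes> v" and a: "a \<in> bidegree_space (m + n, - m) n"
      and v: "v \<in> weight_space \<rho> n"
      unfolding homogeneous_tensors_def by blast
    have xc: "x \<in> cotensor \<rho>" using step(1) span cs.span_base by blast
    have cx: "c *\<^sub>C x \<in> cotensor \<rho>" by (rule cs.subspace_scale[OF subspace_cotensor xc])
    have yc: "y \<in> cotensor \<rho>" using step by blast
    have "L x = ?T x"
      unfolding x hom[OF a v]
      by (simp add: tensor_map_torus_phase_tensor torus_phase_bidegree[OF a] tensor_scale_left)
    then have "L (c *\<^sub>C x + y) = ?T (c *\<^sub>C x + y)"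
      using step by (simp add: add[OF cx yc] scale[OF xc xc] clinear_add[OF clinear_tensor_map]
          clinear_scale[OF clinear_tensor_map])
    then show ?case using cs.subspace_add[OF subspace_cotensor cx yc] by blast
  qed
  then show ?thesis ..
qed

lemma tensor_map_torus_phase_cotensor:
  assumes "left_comodule \<rho>" "s \<in> cotensor \<rho>"
  shows "tensor_map (torus_phase \<theta>) (\<lambda>v. v) s \<in> cotensor \<rho>"
proof -
  have "s \<in> cs.span (homogeneous_tensors \<rho>)" using assms cotensor_eq_span by blast
  then show ?thesis
  proof (induction rule: cs.span_induct_alt)
    case base
    show ?case
      by (simp add: clinear_0[OF clinear_tensor_map] cs.subspace_0[OF subspace_cotensor])
  next
    case (step c x y)
    then obtain a v m n where x: "x = a \<otimes> v" and a: "a \<in> bidegree_space (m + n, - m) n"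
      unfolding homogeneous_tensors_def by blast
    have "x \<in> cotensor \<rho>" using step(1) cotensor_eq_span[OF assms(1)] cs.span_base by blast
    then have "tensor_map (torus_phase \<theta>) (\<lambda>v. v) x \<in> cotensor \<rho>"
      by (simp add: x tensor_map_torus_phase_tensor torus_phase_bidegree[OF a] tensor_scale_left
          cs.subspace_scale[OF subspace_cotensor])
    then show ?case
      using step by (simp add: clinear_add[OF clinear_tensor_map] clinear_scale[OF clinear_tensor_map]
          cs.subspace_add[OF subspace_cotensor] cs.subspace_scale[OF subspace_cotensor])
  qed
qed

lemma tensor_map_torus_phase_uminus:
  "tensor_map (torus_phase (- \<theta>)) (\<lambda>v. v) (tensor_map (torus_phase \<theta>) (\<lambda>v. v) s) = s"
  by (induction s)
    (simp_all add: tensor_map_torus_phase_tensor torus_phase_uminus clinear_add[OF clinear_tensor_map])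

section \<open>Compatibility with the action of coinvariants\<close>

lemma module_act_tensor:
  assumes "cbilinear \<mu>"
  shows "module_act \<mu> b (a \<otimes> v) = \<mu> b a \<otimes> v"
  unfolding module_act_def
  by (rule tensor_map_tensor[OF _ clinear_ident]) (use assms in \<open>simp add: cbilinear_def\<close>)

lemma clinear_module_act: "clinear (module_act \<mu> b)"
  unfolding module_act_def by (rule clinear_tensor_map)

lemma cbilinear_OS3_mult: "cbilinear ((*) :: OS3 \<Rightarrow> OS3 \<Rightarrow> OS3)"
  by (rule cbilinearI) (simp_all add: distrib_left distrib_right scaleC_mult_left scaleC_mult_right)

lemma module_act_cotensor:
  assumes "left_comodule \<rho>" "b \<in> coinvariants" "s \<in> cotensor \<rho>"
  shows "module_act (*) b s \<in> cotensor \<rho>"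
proof -
  note lin = clinear_module_act
  have "s \<in> cs.span (homogeneous_tensors \<rho>)" using assms cotensor_eq_span by blast
  then show ?thesis
  proof (induction rule: cs.span_induct_alt)
    case base
    show ?case by (simp add: clinear_0[OF lin] cs.subspace_0[OF subspace_cotensor])
  next
    case (step c x y)
    then obtain a v m n where x: "x = a \<otimes> v" and a: "a \<in> bidegree_space (m + n, - m) n"
      and v: "v \<in> weight_space \<rho> n"
      unfolding homogeneous_tensors_def by blast
    have "coact_circle (b * a) = (b * a) \<otimes> tpow n"
      using a assms(2)
      by (simp add: coact_circle_mult coinvariants_def bidegree_space_def mult_tensor_tensor)
    then have "module_act (*) b x \<in> cotensor \<rho>"
      unfolding x module_act_tensor[OF cbilinear_OS3_mult]
      by (rule tensor_in_cotensor[OF left_comoduleD(1)[OF assms(1)] _ v])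
    then show ?case
      using step by (simp add: clinear_add[OF lin] clinear_scale[OF lin]
          cs.subspace_add[OF subspace_cotensor] cs.subspace_scale[OF subspace_cotensor])
  qed
qed

lemma is_L_map_is_module_iso:
  assumes "left_comodule \<rho>" "is_L_map \<theta> \<rho> L"
  shows "is_module_iso \<theta> \<rho> L"
proof -
  let ?T = "\<lambda>\<theta>. tensor_map (torus_phase \<theta>) (\<lambda>v::'a. v)"
  note eq = is_L_map_eq_tensor_map[OF assms]
  have "?T \<theta> (?T (- \<theta>) s) = s" for s
    using tensor_map_torus_phase_uminus[of "- \<theta>" s] by simp
  then have "bij_betw (?T \<theta>) (cotensor \<rho>) (cotensor \<rho>)"
    by (intro bij_betw_byWitness[where f' = "?T (- \<theta>)"])
      (auto simp: tensor_map_torus_phase_uminus tensor_map_torus_phase_cotensor[OF assms(1)])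
  then have "bij_betw L (cotensor \<rho>) (cotensor \<rho>)"
    by (subst bij_betw_cong[OF eq])
  moreover have "L (module_act (*) b s) = module_act (star_prod \<theta>) b (L s)"
    if b: "b \<in> coinvariants" and s: "s \<in> cotensor \<rho>" for b s
  proof -
    \<comment> \<open>No membership in the cotensor product is assumed of \<open>x\<close>, so
      induction over pure tensors applies.\<close>
    have "?T \<theta> (module_act (*) b x) = module_act (star_prod \<theta>) b (?T \<theta> x)" for x
      by (induction x)
        (simp_all add: module_act_tensor cbilinear_OS3_mult cbilinear_star_prod
          tensor_map_torus_phase_tensor torus_phase_mult_coinvariant[OF b]
          clinear_add[OF clinear_module_act] clinear_add[OF clinear_tensor_map])
    then show ?thesis
      by (simp add: eq[OF s] eq[OF module_act_cotensor[OF assms(1) b s]])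
  qed
  ultimately show ?thesis
    using assms(2) unfolding is_module_iso_def is_L_map_def by blast
qed

section \<open>Failure of gauge equivariance\<close>

text \<open>Evaluation at the point of the sphere with both coordinates \<open>sqrt (1 / 2)\<close>.
  No generator vanishes there, so it certifies that monomials are nonzero in the quotient.\<close>

lift_definition point_eval :: "OS3 \<Rightarrow> complex" is "poly_eval (\<lambda>_. complex_of_real (sqrt (1 / 2)))"
proof -
  let ?c = "complex_of_real (sqrt (1 / 2))"
  fix p q assume "sphere_eq p q"
  moreover have "?c * ?c + ?c * ?c = 1"
    by (simp flip: of_real_mult of_real_add)
  ultimately have "poly_eval (\<lambda>_. ?c) (p - q) = 0"
    unfolding sphere_eq_def by (intro poly_eval_sphere_ideal)
  then show "poly_eval (\<lambda>_. ?c) p = poly_eval (\<lambda>_. ?c) q" by (simp add: poly_eval_diff)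
qed

lemma point_eval_mult: "point_eval (a * b) = point_eval a * point_eval b"
  and point_eval_1: "point_eval 1 = 1"
  by (transfer, rule poly_eval_mult) (transfer, rule poly_eval_1)

lemma point_eval_sgen: "point_eval (sgen g) \<noteq> 0"
  by transfer (simp add: poly_eval_gvar)

lemma point_eval_power: "point_eval (a ^ n) = point_eval a ^ n"
  by (induction n) (simp_all add: point_eval_1 point_eval_mult)

lemma point_eval_0: "point_eval 0 = 0"
  by transfer (simp add: clinear_0[OF clinear_poly_eval])

text \<open>The witness is a power of \<open>sgen Z1\<close> or of \<open>sgen Z1s\<close>,
  according to the sign of \<open>n\<close>. A nonzero value, unlike mere nonvanishing, is inherited
  by products.\<close>

lemma bidegree_space_point_eval_nonzero:
  obtains a where "a \<in> bidegree_space (n, 0) n" "point_eval a \<noteq> 0"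
proof (cases "n \<ge> 0")
  case True
  have "sgen Z1 \<in> bidegree_space (1, 0) 1" using sgen_bidegree[of Z1] by simp
  from bidegree_space_power[OF this, of "nat n"] True show ?thesis
    by (intro that[of "sgen Z1 ^ nat n"]) (simp_all add: point_eval_power point_eval_sgen)
next
  case False
  have "sgen Z1s \<in> bidegree_space (- 1, 0) (- 1)" using sgen_bidegree[of Z1s] by simp
  from bidegree_space_power[OF this, of "nat (- n)"] False show ?thesis
    by (intro that[of "sgen Z1s ^ nat (- n)"]) (simp_all add: point_eval_power point_eval_sgen)
qed

text \<open>Multiplying by \<open>phase \<theta> n\<close> makes the phase at \<open>n + n\<close>
  equal to 1. Its real part alone already forces \<open>pi * \<theta> * (n + n)\<close> to be a
  multiple of \<open>2 * pi\<close>.\<close>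

lemma phase_eq_uminus_imp_Ints:
  assumes "phase \<theta> n = phase \<theta> (- n)"
  shows "of_int n * \<theta> \<in> \<int>"
proof -
  have "phase \<theta> (n + n) = phase \<theta> (- n + n)"
    by (simp only: phase_add assms)
  then have "exp (\<i> * complex_of_real (pi * \<theta> * of_int (n + n))) = 1"
    by (simp add: mult_ac)
  then have "cos (pi * \<theta> * of_int (n + n)) = 1"
    by (metis cis.sel(1) cis_conv_exp one_complex.sel(1))
  then obtain k :: int where "pi * \<theta> * of_int (n + n) = of_int k * 2 * pi"
    by (auto simp: cos_one_2pi_int)
  then have "of_int n * \<theta> = of_int k" by (simp add: field_simps)
  then show ?thesis by simp
qed

text \<open>With \<open>b = z\<^sub>1 z\<^sub>2\<^sup>*\<close> and \<open>a\<close> of bidegree \<open>((n, 0), n)\<close>, acting before or after \<open>L\<close> multiplies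
  \<open>n (a b \<otimes> v)\<close> by \<open>exp (\<pi> \<i> \<theta> n)\<close> and \<open>exp (- \<pi> \<i> \<theta> n)\<close> respectively.\<close>

lemma not_intertwines_gauge_of_weight:
  assumes comodule: "left_comodule \<rho>" and L: "is_L_map \<theta> \<rho> L"
    and v: "v \<in> weight_space \<rho> n" "v \<noteq> 0" and n\<theta>: "of_int n * \<theta> \<notin> \<int>"
  shows "\<not> intertwines_gauge \<theta> \<rho> L"
proof
  assume intertwines: "intertwines_gauge \<theta> \<rho> L"
  note lin = left_comoduleD(1)[OF comodule]
  obtain a where a: "a \<in> bidegree_space (n, 0) n" and a0: "point_eval a \<noteq> 0"
    by (rule bidegree_space_point_eval_nonzero)
  define b where "b = sgen Z1 * sgen Z2s"
  have b: "b \<in> bidegree_space (1, - 1) 0"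
    using bidegree_space_mult[OF sgen_bidegree[of Z1] sgen_bidegree[of Z2s]] by (simp add: b_def)
  have ab: "a * b \<in> bidegree_space (1 + n, - 1) n"
    using bidegree_space_mult[OF a b] by (simp add: add.commute)
  have L_hom: "L (x \<otimes> w) = phase \<theta> (m * n) *\<^sub>C x \<otimes> w"
    if "x \<in> bidegree_space (m + n, - m) n" "w \<in> weight_space \<rho> n" for x w m
    using L that unfolding is_L_map_def by blast
  \<comment> \<open>In the format \<open>(m + n, - m)\<close> the element \<open>a\<close> has
    \<open>m = 0\<close>, so \<open>L\<close> fixes \<open>a \<otimes> v\<close>; multiplication by
    \<open>b\<close> raises \<open>m\<close> to 1.\<close>
  have La: "L (a \<otimes> v) = a \<otimes> v"
    using L_hom[of a 0 v] a v(1) by simp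
  have av: "a \<otimes> v \<in> cotensor \<rho>"
    using a v(1) by (intro tensor_in_cotensor[OF lin]) (simp_all add: bidegree_space_def)
  have "clinear (trivial_coact :: circle_der \<Rightarrow> _)"
    by (rule clinearI) (simp_all add: trivial_coact_def tensor_simps)
  then have bX: "b \<otimes> circle_X \<in> cotensor trivial_coact"
    using b by (intro tensor_in_cotensor[where n = 0])
      (simp_all add: bidegree_space_def weight_space_def trivial_coact_def tpow_0)
  define w where "w = complex_of_int n *\<^sub>C v"
  have w: "der_act \<rho> circle_X v = w"
    by (simp add: der_act_weight[OF v(1)] circle_X_tpow w_def)
  have "w \<in> weight_space \<rho> n"
    using v(1) by (simp add: w_def weight_space_def clinear_scale[OF lin] tensor_scale_right)
  then have "L ((a * b) \<otimes> w) = phase \<theta> n *\<^sub>C (a * b) \<otimes> w"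
    using L_hom[of "a * b" 1 w] ab by simp
  moreover have "L (gauge_act (*) \<rho> (a \<otimes> v) (b \<otimes> circle_X)) =
      gauge_act (star_prod \<theta>) \<rho> (L (a \<otimes> v)) (b \<otimes> circle_X)"
    using intertwines av bX unfolding intertwines_gauge_def by blast
  ultimately have "phase \<theta> n *\<^sub>C (a * b) \<otimes> w = star_prod \<theta> a b \<otimes> w"
    by (simp add: La gauge_act_tensor[OF cbilinear_OS3_mult lin]
        gauge_act_tensor[OF cbilinear_star_prod lin] w)
  \<comment> \<open>For the torus degrees \<open>(n, 0)\<close> and \<open>(1, - 1)\<close> the
    exponent is \<open>n * (- 1) - 0 * 1 = - n\<close>.\<close>
  also have "star_prod \<theta> a b \<otimes> w = phase \<theta> (- n) *\<^sub>C (a * b) \<otimes> w"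
    using star_prod_bidegree[OF a b, of \<theta>] by (simp add: tensor_scale_left)
  finally have eq: "phase \<theta> n *\<^sub>C (a * b) \<otimes> w = phase \<theta> (- n) *\<^sub>C (a * b) \<otimes> w" .
  \<comment> \<open>Weight 0 is excluded because \<open>0 * \<theta>\<close> is an integer; hence
    \<open>circle_X\<close> does not annihilate \<open>v\<close>.\<close>
  have "n \<noteq> 0" using n\<theta> by auto
  then have "w \<noteq> 0" using v(2) by (simp add: w_def)
  moreover have "point_eval (a * b) \<noteq> 0"
    by (simp add: b_def point_eval_mult a0 point_eval_sgen)
  then have "a * b \<noteq> 0" using point_eval_0 by metis
  ultimately have "(a * b) \<otimes> w \<noteq> 0" by (intro tensor_nonzero)
  then have "phase \<theta> n = phase \<theta> (- n)" using eq by (simp only: cs.scale_cancel_right) blast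
  then show False using n\<theta> phase_eq_uminus_imp_Ints by blast
qed

lemma Rats_of_int_mult_in_Ints:
  fixes x :: real
  assumes "n \<noteq> 0" "of_int n * x \<in> \<int>"
  shows "x \<in> \<rat>"
proof -
  obtain k :: int where "of_int n * x = of_int k" using assms(2) by (auto simp: Ints_def)
  then have "x = of_int k / of_int n" using assms(1) by (simp add: field_simps)
  then show ?thesis by simp
qed

text \<open>Non-triviality of the coaction alone does not prevent intertwining: for
  \<open>\<theta> = 0\<close> both actions coincide and \<open>L\<close> is the identity on the
  cotensor product. In general, acting by a coinvariant of torus degree \<open>(k, - k)\<close> on
  weight \<open>n\<close> makes the two sides differ by the factor
  \<open>exp (2 pi i \<theta> k n)\<close>, which is 1 for all \<open>k\<close> exactly when
  \<open>n * \<theta>\<close> is an integer. The hypothesis \<open>nondegenerate\<close> supplies an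
  occurring weight for which this fails.\<close>

theorem proposition5p1:
  fixes \<theta> :: real
    and \<rho> :: "'v::complex_space \<Rightarrow> (OU1, 'v) tensor"
    and L :: "(OS3, 'v) tensor \<Rightarrow> (OS3, 'v) tensor"
  assumes comodule: "left_comodule \<rho>"
    and nontrivial: "\<exists>v. \<rho> v \<noteq> 1 \<otimes> v"
    and nondegenerate: "\<theta> \<notin> \<rat> \<or> (\<exists>n. weight_space \<rho> n \<noteq> {0} \<and> of_int n * \<theta> \<notin> \<int>)"
    and L: "is_L_map \<theta> \<rho> L"
  shows "is_module_iso \<theta> \<rho> L \<and> \<not> intertwines_gauge \<theta> \<rho> L"
proof
  show "is_module_iso \<theta> \<rho> L" by (rule is_L_map_is_module_iso[OF comodule L])
  have "\<exists>n v. v \<in> weight_space \<rho> n \<and> v \<noteq> 0 \<and> of_int n * \<theta> \<notin> \<int>"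
    using nondegenerate
  proof
    assume "\<theta> \<notin> \<rat>"
    then show ?thesis
      using exists_nonzero_weight[OF comodule nontrivial] Rats_of_int_mult_in_Ints by metis
  next
    assume "\<exists>n. weight_space \<rho> n \<noteq> {0} \<and> of_int n * \<theta> \<notin> \<int>"
    then obtain n where n: "weight_space \<rho> n \<noteq> {0}" "of_int n * \<theta> \<notin> \<int>" by blast
    \<comment> \<open>As 0 always belongs to the weight space, being different from
      \<open>{0}\<close> yields a nonzero vector.\<close>
    have "0 \<in> weight_space \<rho> n"
      using tensor_scale_right[of "tpow n" 0 "0::'v"]
      by (simp add: weight_space_def clinear_0[OF left_comoduleD(1)[OF comodule]])
    then show ?thesis using n by blast
  qed
  then show "\<not> intertwines_gauge \<theta> \<rho> L"
    using not_intertwines_gauge_of_weight[OF comodule L] by blast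
qed

end
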